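(* Let $K$ and $K'$ be algebraically closed fields of the same characteristic, let $E_1,E_2$ be directed graphs, and let $X_{E_i}\subseteq\mathrm{Reg}(E_i)$ for $i=1,2$. Assume that $C_K^{X_{E_1}}(E_1)$ is finite-dimensional over $K$. Then $C_K^{X_{E_1}}(E_1)\cong C_K^{X_{E_2}}(E_2)$ as $K$-algebras if and only if $C_{K'}^{X_{E_1}}(E_1)\cong C_{K'}^{X_{E_2}}(E_2)$ as $K'$-algebras.
   Context: A directed graph $E=(E^0,E^1,r,s)$ consists of two sets $E^0$ (vertices) and $E^1$ (edges) and functions $r,s\colon E^1\to E^0$. A vertex $v$ is regular if $s^{-1}(v)$ is a finite non-empty set; $\mathrm{Reg}(E)$ is the set of regular vertices. For a commutative unital ring $R$ and a subset $X\subseteq\mathrm{Reg}(E)$, the Cohn path algebra of $E$ relative to $X$, denoted $C_R^{X}(E)$, is the free (associative, not necessarily unital) $R$-algebra generated by $E^0\cup E^1\cup\{e^*: e\in E^1\}$ subject to the relations: (V) $vw=\delta_{v,w}v$ for $v,w\in E^0$; (E1) $s(e)e=er(e)=e$ for $e\in E^1$; (E2) $r(e)e^*=e^*s(e)=e^*$ for $e\in E^1$; (CK1) $e^*f=\delta_{e,f}r(e)$ for $e,f\in E^1$; (XCK2) $v=\sum_{e\in s^{-1}(v)}ee^*$ for every $v\in X$. *)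

theory Defs
  imports
    "HOL-Library.Poly_Mapping"
    "HOL-Computational_Algebra.Computational_Algebra"
    "HOL-Algebra.Congruence"
    "Graph_Theory.Digraph"
begin

text \<open>
  A directed graph is a well-formed digraph of \<^theory>\<open>Graph_Theory.Digraph\<close>, with
  \<^const>\<open>tail\<close> as the source map \<open>s\<close> and \<^const>\<open>head\<close> as the range map \<open>r\<close>. Vertex and arc
  sets may be infinite, and loops and multiple arcs are allowed.
\<close>

definition regular_verts :: "('v, 'e) pre_digraph \<Rightarrow> 'v set" where
  "regular_verts G = {v \<in> verts G. finite (out_arcs G v) \<and> out_arcs G v \<noteq> {}}"


section \<open>Algebras that need not have a unit\<close>

text \<open>The scalars range over the whole type \<open>'k\<close>; the vectors over the carrier only.\<close>

record ('k, 'a) nu_algebra = "'a partial_object" +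
  alg_zero :: 'a
  alg_add :: "'a \<Rightarrow> 'a \<Rightarrow> 'a"
  alg_mult :: "'a \<Rightarrow> 'a \<Rightarrow> 'a"
  alg_smult :: "'k \<Rightarrow> 'a \<Rightarrow> 'a"

definition alg_iso :: "('k, 'a) nu_algebra \<Rightarrow> ('k, 'b) nu_algebra \<Rightarrow> ('a \<Rightarrow> 'b) \<Rightarrow> bool" where
  "alg_iso A B h \<longleftrightarrow> bij_betw h (carrier A) (carrier B) \<and>
     (\<forall>x \<in> carrier A. \<forall>y \<in> carrier A. h (alg_add A x y) = alg_add B (h x) (h y)) \<and>
     (\<forall>x \<in> carrier A. \<forall>y \<in> carrier A. h (alg_mult A x y) = alg_mult B (h x) (h y)) \<and>
     (\<forall>c. \<forall>x \<in> carrier A. h (alg_smult A c x) = alg_smult B c (h x))"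

definition alg_isomorphic :: "('k, 'a) nu_algebra \<Rightarrow> ('k, 'b) nu_algebra \<Rightarrow> bool"
    (infix \<open>\<cong>\<^sub>a\<close> 50) where
  "A \<cong>\<^sub>a B \<longleftrightarrow> (\<exists>h. alg_iso A B h)"

inductive_set alg_span :: "('k, 'a) nu_algebra \<Rightarrow> 'a set \<Rightarrow> 'a set"
  for A :: "('k, 'a) nu_algebra" and B :: "'a set" where
  zero: "alg_zero A \<in> alg_span A B"
| step: "x \<in> alg_span A B \<Longrightarrow> b \<in> B \<Longrightarrow> alg_add A x (alg_smult A c b) \<in> alg_span A B"

definition alg_finite_dim :: "('k::field, 'a) nu_algebra \<Rightarrow> bool" where
  "alg_finite_dim A \<longleftrightarrow> (\<exists>B. finite B \<and> B \<subseteq> carrier A \<and> alg_span A B = carrier A)"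


section \<open>Free algebras and their quotients\<close>

text \<open>
  Words under concatenation form a monoid, written additively so that the convolution product of
  \<^theory>\<open>HOL-Library.Poly_Mapping\<close> makes \<open>'g list \<Rightarrow>\<^sub>0 'k\<close> the free unital algebra on \<open>'g\<close>.
\<close>

instantiation list :: (type) monoid_add
begin

definition zero_list :: "'a list" where "zero_list = []"

definition plus_list :: "'a list \<Rightarrow> 'a list \<Rightarrow> 'a list" where "plus_list = (@)"

instance
  by standard (simp_all add: zero_list_def plus_list_def)

end

type_synonym ('g, 'k) ncpoly = "'g list \<Rightarrow>\<^sub>0 'k"

definition gen :: "'g \<Rightarrow> ('g, 'k::comm_ring_1) ncpoly" where
  "gen x = Poly_Mapping.single [x] 1"

definition scale :: "'k \<Rightarrow> ('g, 'k::comm_ring_1) ncpoly \<Rightarrow> ('g, 'k) ncpoly" where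
  "scale c p = Poly_Mapping.map ((*) c) p"

text \<open>The free algebra without unit on \<open>S\<close>: the empty word must not occur.\<close>

definition free_alg :: "'g set \<Rightarrow> ('g, 'k::comm_ring_1) ncpoly set" where
  "free_alg S = {p. Poly_Mapping.keys p \<subseteq> lists S - {[]}}"

inductive_set gen_ideal :: "'g set \<Rightarrow> ('g, 'k::comm_ring_1) ncpoly set \<Rightarrow> ('g, 'k) ncpoly set"
  for S :: "'g set" and R :: "('g, 'k) ncpoly set" where
  base: "p \<in> R \<Longrightarrow> p \<in> gen_ideal S R"
| zero: "0 \<in> gen_ideal S R"
| add: "p \<in> gen_ideal S R \<Longrightarrow> q \<in> gen_ideal S R \<Longrightarrow> p + q \<in> gen_ideal S R"
| scale: "p \<in> gen_ideal S R \<Longrightarrow> scale c p \<in> gen_ideal S R"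
| mult_left: "f \<in> free_alg S \<Longrightarrow> p \<in> gen_ideal S R \<Longrightarrow> f * p \<in> gen_ideal S R"
| mult_right: "p \<in> gen_ideal S R \<Longrightarrow> f \<in> free_alg S \<Longrightarrow> p * f \<in> gen_ideal S R"

definition coset :: "('g, 'k::comm_ring_1) ncpoly set \<Rightarrow> ('g, 'k) ncpoly \<Rightarrow> ('g, 'k) ncpoly set"
  where "coset I p = (\<lambda>i. p + i) ` I"

text \<open>
  The algebra on \<open>S\<close> presented by the relators \<open>R\<close>. The operations take the union over all
  representatives, which is a single coset by the lemmas \<open>presented_alg_add\<close>,
  \<open>presented_alg_mult\<close> and \<open>presented_alg_smult\<close> below.
\<close>

definition presented_alg :: "'g set \<Rightarrow> ('g, 'k::comm_ring_1) ncpoly set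
    \<Rightarrow> ('k, ('g, 'k) ncpoly set) nu_algebra" where
  "presented_alg S R = (let I = gen_ideal S R in
     \<lparr>carrier = coset I ` free_alg S,
      alg_zero = coset I 0,
      alg_add = (\<lambda>P Q. \<Union>p\<in>P. \<Union>q\<in>Q. coset I (p + q)),
      alg_mult = (\<lambda>P Q. \<Union>p\<in>P. \<Union>q\<in>Q. coset I (p * q)),
      alg_smult = (\<lambda>c P. \<Union>p\<in>P. coset I (scale c p))\<rparr>)"

lemma lookup_scale: "Poly_Mapping.lookup (scale c p) w = c * Poly_Mapping.lookup p w"
  by (simp add: scale_def Poly_Mapping.map.rep_eq when_def)

lemma scale_minus_one: "scale (-1) p = - p"
  by (rule poly_mapping_eqI) (simp add: lookup_scale)

lemma scale_add_right: "scale c (p + q) = scale c p + scale c q"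
  by (rule poly_mapping_eqI) (simp add: lookup_scale lookup_add algebra_simps)

lemma gen_ideal_uminus: "p \<in> gen_ideal S R \<Longrightarrow> - p \<in> gen_ideal S R"
  using gen_ideal.scale[of p S R "-1"] by (simp add: scale_minus_one)

lemma coset_eqI:
  assumes "p - q \<in> gen_ideal S R"
  shows "coset (gen_ideal S R) p = coset (gen_ideal S R) q"
proof -
  have *: "coset (gen_ideal S R) p \<subseteq> coset (gen_ideal S R) q"
    if "p - q \<in> gen_ideal S R" for p q :: "('a, 'b) ncpoly"
  proof
    fix x assume "x \<in> coset (gen_ideal S R) p"
    then obtain i where i: "i \<in> gen_ideal S R" "x = p + i" by (auto simp: coset_def)
    then have "x = q + ((p - q) + i)" by (simp add: algebra_simps)
    with i that show "x \<in> coset (gen_ideal S R) q"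
      unfolding coset_def by (blast intro: gen_ideal.add)
  qed
  have "q - p \<in> gen_ideal S R"
    using gen_ideal_uminus[OF assms] by simp
  with assms show ?thesis by (intro equalityI *)
qed

lemma coset_self: "p \<in> coset (gen_ideal S R) p"
  unfolding coset_def by (rule image_eqI[of _ _ 0]) (auto intro: gen_ideal.zero)

lemma free_alg_add: "p \<in> free_alg S \<Longrightarrow> q \<in> free_alg S \<Longrightarrow> p + q \<in> free_alg S"
  using keys_add[of p q] by (auto simp: free_alg_def)

lemma free_alg_scale: "p \<in> free_alg S \<Longrightarrow> scale c p \<in> free_alg S"
proof -
  have "Poly_Mapping.keys (scale c p) \<subseteq> Poly_Mapping.keys p"
    by (auto simp: in_keys_iff lookup_scale)
  then show "p \<in> free_alg S \<Longrightarrow> scale c p \<in> free_alg S"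
    unfolding free_alg_def by blast
qed

lemma free_alg_mult: "p \<in> free_alg S \<Longrightarrow> q \<in> free_alg S \<Longrightarrow> p * q \<in> free_alg S"
  using keys_mult[of p q] by (fastforce simp: free_alg_def plus_list_def)

lemma gen_ideal_subset:
  assumes "R \<subseteq> free_alg S"
  shows "gen_ideal S R \<subseteq> free_alg S"
proof
  fix x assume "x \<in> gen_ideal S R"
  then show "x \<in> free_alg S"
    by induction (use assms in \<open>auto intro: free_alg_add free_alg_scale free_alg_mult\<close>,
      simp add: free_alg_def)
qed

lemma presented_alg_add:
  "alg_add (presented_alg S R) (coset (gen_ideal S R) p) (coset (gen_ideal S R) q)
    = coset (gen_ideal S R) (p + q)"
proof -
  have "coset (gen_ideal S R) (p' + q') = coset (gen_ideal S R) (p + q)"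
    if "p' \<in> coset (gen_ideal S R) p" "q' \<in> coset (gen_ideal S R) q" for p' q'
  proof (rule coset_eqI)
    from that obtain i j where "i \<in> gen_ideal S R" "j \<in> gen_ideal S R" "p' = p + i" "q' = q + j"
      by (auto simp: coset_def)
    then show "p' + q' - (p + q) \<in> gen_ideal S R"
      using gen_ideal.add[of i S R j] by (simp add: algebra_simps)
  qed
  then show ?thesis
    unfolding presented_alg_def Let_def nu_algebra.simps
    by (intro SUP_eq_const) (use coset_self in blast)+
qed

lemma presented_alg_smult:
  "alg_smult (presented_alg S R) c (coset (gen_ideal S R) p) = coset (gen_ideal S R) (scale c p)"
proof -
  have "coset (gen_ideal S R) (scale c p') = coset (gen_ideal S R) (scale c p)"
    if "p' \<in> coset (gen_ideal S R) p" for p'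
  proof (rule coset_eqI)
    from that obtain i where "i \<in> gen_ideal S R" "p' = p + i"
      by (auto simp: coset_def)
    then show "scale c p' - scale c p \<in> gen_ideal S R"
      using gen_ideal.scale[of i S R c] by (simp add: scale_add_right)
  qed
  then show ?thesis
    unfolding presented_alg_def Let_def nu_algebra.simps
    by (intro SUP_eq_const) (use coset_self in blast)+
qed

lemma presented_alg_mult:
  assumes "R \<subseteq> free_alg S" "p \<in> free_alg S" "q \<in> free_alg S"
  shows "alg_mult (presented_alg S R) (coset (gen_ideal S R) p) (coset (gen_ideal S R) q)
    = coset (gen_ideal S R) (p * q)"
proof -
  have "coset (gen_ideal S R) (p' * q') = coset (gen_ideal S R) (p * q)"
    if "p' \<in> coset (gen_ideal S R) p" "q' \<in> coset (gen_ideal S R) q" for p' q'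
  proof (rule coset_eqI)
    from that obtain i j where ij: "i \<in> gen_ideal S R" "j \<in> gen_ideal S R"
        "p' = p + i" "q' = q + j"
      by (auto simp: coset_def)
    have "p' * q' - p * q = p * j + i * (q + j)"
      using ij by (simp add: algebra_simps)
    moreover have "q + j \<in> free_alg S"
      using assms ij gen_ideal_subset[OF assms(1)] by (auto intro: free_alg_add)
    ultimately show "p' * q' - p * q \<in> gen_ideal S R"
      using assms ij by (auto intro: gen_ideal.intros)
  qed
  then show ?thesis
    unfolding presented_alg_def Let_def nu_algebra.simps
    by (intro SUP_eq_const) (use coset_self in blast)+
qed


section \<open>Cohn path algebras\<close>

datatype ('v, 'e) cohn_gen = Vert 'v | Edge 'e | Ghost 'e

definition cohn_gens :: "('v, 'e) pre_digraph \<Rightarrow> ('v, 'e) cohn_gen set" where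
  "cohn_gens G = Vert ` verts G \<union> Edge ` arcs G \<union> Ghost ` arcs G"

text \<open>A relation \<open>a = b\<close> is recorded as the relator \<open>a - b\<close>.\<close>

inductive_set cohn_relators ::
    "('v, 'e) pre_digraph \<Rightarrow> 'v set \<Rightarrow> (('v, 'e) cohn_gen, 'k::comm_ring_1) ncpoly set"
  for G :: "('v, 'e) pre_digraph" and X :: "'v set" where
  V: "v \<in> verts G \<Longrightarrow> w \<in> verts G \<Longrightarrow>
    gen (Vert v) * gen (Vert w) - (if v = w then gen (Vert v) else 0) \<in> cohn_relators G X"
| E1_source: "e \<in> arcs G \<Longrightarrow>
    gen (Vert (tail G e)) * gen (Edge e) - gen (Edge e) \<in> cohn_relators G X"
| E1_range: "e \<in> arcs G \<Longrightarrow>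
    gen (Edge e) * gen (Vert (head G e)) - gen (Edge e) \<in> cohn_relators G X"
| E2_range: "e \<in> arcs G \<Longrightarrow>
    gen (Vert (head G e)) * gen (Ghost e) - gen (Ghost e) \<in> cohn_relators G X"
| E2_source: "e \<in> arcs G \<Longrightarrow>
    gen (Ghost e) * gen (Vert (tail G e)) - gen (Ghost e) \<in> cohn_relators G X"
| CK1: "e \<in> arcs G \<Longrightarrow> f \<in> arcs G \<Longrightarrow>
    gen (Ghost e) * gen (Edge f) - (if e = f then gen (Vert (head G e)) else 0)
      \<in> cohn_relators G X"
| XCK2: "v \<in> X \<Longrightarrow>
    gen (Vert v) - (\<Sum>e \<in> out_arcs G v. gen (Edge e) * gen (Ghost e)) \<in> cohn_relators G X"

text \<open>Meaningful for \<open>X \<subseteq> regular_verts G\<close>, which makes the sums in \<open>XCK2\<close> finite.\<close>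

definition cohn_path_algebra :: "'k::comm_ring_1 itself \<Rightarrow> ('v, 'e) pre_digraph \<Rightarrow> 'v set
    \<Rightarrow> ('k, (('v, 'e) cohn_gen, 'k) ncpoly set) nu_algebra" where
  "cohn_path_algebra _ G X = presented_alg (cohn_gens G) (cohn_relators G X)"

lemma gen_in_free_alg: "x \<in> S \<Longrightarrow> gen x \<in> free_alg S"
  by (simp add: gen_def free_alg_def)

lemma free_alg_diff: "p \<in> free_alg S \<Longrightarrow> q \<in> free_alg S \<Longrightarrow> p - q \<in> free_alg S"
  using keys_diff[of p q] by (auto simp: free_alg_def)

lemma free_alg_zero: "0 \<in> free_alg S"
  by (simp add: free_alg_def)

lemma free_alg_sum: "(\<And>x. x \<in> A \<Longrightarrow> f x \<in> free_alg S) \<Longrightarrow> sum f A \<in> free_alg S"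
  by (induction A rule: infinite_finite_induct) (auto intro: free_alg_zero free_alg_add)

lemma cohn_relators_subset:
  assumes "wf_digraph G" "X \<subseteq> regular_verts G"
  shows "cohn_relators G X \<subseteq> free_alg (cohn_gens G)"
proof
  interpret wf_digraph G by fact
  fix x assume "x \<in> cohn_relators G X"
  then show "x \<in> free_alg (cohn_gens G)"
    by cases (use assms in \<open>auto simp: cohn_gens_def regular_verts_def
      intro!: free_alg_diff free_alg_mult free_alg_sum free_alg_zero gen_in_free_alg\<close>)
qed

end

theory Submission
  imports Defs "Graph_Theory.Arc_Walk" "HOL-Library.Function_Algebras"
begin

text \<open>
  A finite-dimensional Cohn path algebra is a direct product of matrix algebras whose number and
  sizes can be read off the graph. Two such algebras are isomorphic if and only if the sizes agree
  up to order, and this condition does not mention the field.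

  In detail, consider the walks of a graph \<open>G\<close> that end at a vertex outside \<open>X\<close>, and call two of
  them equivalent if they end at the same vertex. If \<open>G\<close> has only finitely many walks, then over
  every field \<open>K\<close> the algebra \<open>C\<^sub>K\<^sup>X(G)\<close> is isomorphic to the algebra of matrices indexed by these
  walks with entries between equivalent walks only (\<open>cohn_path_algebra_iso_block_matrices\<close>). The
  matrix units are the elements \<open>p (v - \<Sum>e e\<^sup>*) q\<^sup>*\<close>, where \<open>p\<close> and \<open>q\<close> are walks with the common
  target \<open>v\<close> and \<open>e\<close> runs through the arcs leaving \<open>v\<close>. They are separated by the representation
  on the walks, in which edges prepend and ghost edges remove an arc. They span because a vertex
  can be expanded along its outgoing arcs until all walks have come to an end.

  Finite-dimensionality over one field already forces the set of walks to be finite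
  (\<open>finite_walks_if_finite_dim\<close>), since in a suitable representation, which exists for every graph,
  different walks act by linearly independent operators.

  Matrix algebras of this kind are compared with the uniqueness part of Wedderburn's theorem: an
  isomorphism matches the minimal two-sided ideals, that is the blocks, and preserves their
  dimensions, so it yields a bijection between the index sets compatible with the equivalence
  relations (\<open>bijection_if_block_matrices_iso\<close>); the converse is a relabelling. It follows that
  \<open>C\<^sub>K\<^sup>X(G)\<close> with finitely many walks in \<open>G\<close> is isomorphic to \<open>C\<^sub>K\<^sup>Y(H)\<close> if and only if \<open>H\<close> has
  finitely many walks and these match those of \<open>G\<close> (\<open>cohn_path_algebra_iso_iff\<close>), a condition on
  the graphs alone.
\<close>

section \<open>Point functions\<close>

definition point :: "'a \<Rightarrow> 'a \<Rightarrow> 'k::field" where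
  "point a = (\<lambda>x. if x = a then 1 else 0)"

interpretation fun_space: vector_space "\<lambda>(c::'k::field) (f::'a \<Rightarrow> 'k) x. c * f x"
  by standard (auto simp: fun_eq_iff algebra_simps)

lemma inj_point: "inj (point :: 'a \<Rightarrow> 'a \<Rightarrow> 'k::field)"
proof (rule injI)
  fix a b :: 'a assume "(point a :: 'a \<Rightarrow> 'k) = point b"
  then have "(point a :: 'a \<Rightarrow> 'k) a = point b a" by simp
  then show "a = b" by (simp add: point_def split: if_splits)
qed

lemma sum_fun_apply: "(\<Sum>i\<in>I. f i) x = (\<Sum>i\<in>I. f i x)"
  for f :: "'i \<Rightarrow> 'a \<Rightarrow> 'b::comm_monoid_add"
  by (induction I rule: infinite_finite_induct) auto

text \<open>
  Evaluating a vanishing linear combination of indicator functions at the point of one of them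
  isolates its coefficient.
\<close>

lemma independent_points: "\<not> fun_space.dependent (point ` S :: ('a \<Rightarrow> 'k::field) set)"
proof
  assume "fun_space.dependent (point ` S :: ('a \<Rightarrow> 'k) set)"
  then obtain t and u :: "('a \<Rightarrow> 'k) \<Rightarrow> 'k" and v where t: "finite t" "t \<subseteq> point ` S"
      "(\<Sum>f\<in>t. (\<lambda>x. u f * f x)) = 0" and v: "v \<in> t" "u v \<noteq> 0"
    unfolding fun_space.dependent_explicit by auto
  from t v obtain a where a: "v = point a" by auto
  have "u f * f a = 0" if "f \<in> t - {v}" for f
  proof -
    from that t obtain b where b: "f = point b" by auto
    with that a have "a \<noteq> b" by auto
    with b show ?thesis by (simp add: point_def)
  qed
  then have "(\<Sum>f\<in>t. u f * f a) = u v * v a"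
    using t(1) v(1) by (simp add: sum.remove[of t v] sum.neutral)
  also have "\<dots> = u v" by (simp add: a point_def)
  finally have "(\<Sum>f\<in>t. (\<lambda>x. u f * f x)) a = u v" by (simp add: sum_fun_apply)
  with t(3) v(2) show False by simp
qed

text \<open>
  All dimension arguments below are instances of this bound: in concrete function spaces,
  dimensions are compared by counting indicator functions.
\<close>

lemma card_le_if_points_in_span:
  assumes "finite T" "\<And>s. s \<in> S \<Longrightarrow> (point s :: 'a \<Rightarrow> 'k::field) \<in> fun_space.span T"
  shows "finite S \<and> card S \<le> card T"
proof -
  have "finite (point ` S :: ('a \<Rightarrow> 'k) set) \<and> card (point ` S :: ('a \<Rightarrow> 'k) set) \<le> card T"
    by (rule fun_space.independent_span_bound) (use assms independent_points in auto)
  moreover have "inj_on (point :: 'a \<Rightarrow> 'a \<Rightarrow> 'k) S"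
    using inj_point by (rule inj_on_subset) simp
  ultimately show ?thesis by (auto simp: card_image dest: finite_imageD)
qed

lemma fun_eq_sum_points:
  fixes f :: "'a \<Rightarrow> 'k::field"
  assumes "finite P" "\<And>x. x \<notin> P \<Longrightarrow> f x = 0"
  shows "f = (\<lambda>x. \<Sum>a\<in>P. f a * point a x)"
proof
  fix x
  have "(\<Sum>a\<in>P. f a * point a x) = (\<Sum>a\<in>P. if x = a then f a else 0)"
    by (rule sum.cong) (auto simp: point_def)
  also have "\<dots> = f x" using assms by simp
  finally show "f x = (\<Sum>a\<in>P. f a * point a x)" by simp
qed

section \<open>Representations of free algebras\<close>

text \<open>
  The single-term case may assume that the word occurs in the polynomial at hand. This keeps facts
  such as membership in \<^const>\<open>free_alg\<close>, which constrain the words, usable although the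
  induction does not carry them along.
\<close>

lemma ncpoly_induct [case_names zero single add]:
  fixes p :: "('g, 'k::comm_ring_1) ncpoly"
  assumes "P 0" "\<And>w c. w \<in> Poly_Mapping.keys p \<Longrightarrow> P (Poly_Mapping.single w c)"
    and "\<And>p q. P p \<Longrightarrow> P q \<Longrightarrow> P (p + q)"
  shows "P p"
proof -
  have "P (\<Sum>w\<in>A. Poly_Mapping.single w (Poly_Mapping.lookup p w))"
    if "finite A" "A \<subseteq> Poly_Mapping.keys p" for A
    using that by (induction A) (auto intro: assms)
  then have "P (\<Sum>w\<in>Poly_Mapping.keys p. Poly_Mapping.single w (Poly_Mapping.lookup p w))" by auto
  moreover have "(\<Sum>w\<in>Poly_Mapping.keys p. Poly_Mapping.single w (Poly_Mapping.lookup p w)) = p"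
    by (rule poly_mapping_eqI) (auto simp: lookup_sum lookup_single when_def in_keys_iff)
  ultimately show ?thesis by simp
qed

text \<open>
  The action of the free algebra on all functions \<open>'b \<Rightarrow> 'k\<close> in which a generator \<open>g\<close> acts by
  \<open>op g\<close> and a word by the composite of its letters. Acting on functions, instead of on formal
  linear combinations of points, leaves no finiteness condition on the operators.
\<close>

definition rep :: "('g \<Rightarrow> ('b \<Rightarrow> 'k) \<Rightarrow> 'b \<Rightarrow> 'k) \<Rightarrow> ('g, 'k::field) ncpoly
    \<Rightarrow> ('b \<Rightarrow> 'k) \<Rightarrow> 'b \<Rightarrow> 'k" where
  "rep op p \<phi> b = (\<Sum>w\<in>Poly_Mapping.keys p. Poly_Mapping.lookup p w * foldr op w \<phi> b)"

lemma rep_superset: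
  assumes "finite A" "Poly_Mapping.keys p \<subseteq> A"
  shows "rep op p \<phi> b = (\<Sum>w\<in>A. Poly_Mapping.lookup p w * foldr op w \<phi> b)"
  unfolding rep_def by (rule sum.mono_neutral_left) (use assms in \<open>auto simp: in_keys_iff\<close>)

lemma rep_zero: "rep op 0 \<phi> = (\<lambda>b. 0)"
  by (simp add: rep_def fun_eq_iff)

lemma rep_add: "rep op (p + q) \<phi> = (\<lambda>b. rep op p \<phi> b + rep op q \<phi> b)"
proof
  fix b
  let ?A = "Poly_Mapping.keys p \<union> Poly_Mapping.keys q"
  have "Poly_Mapping.keys (p + q) \<subseteq> ?A" by (rule keys_add)
  then show "rep op (p + q) \<phi> b = rep op p \<phi> b + rep op q \<phi> b"
    by (simp add: rep_superset[of ?A] lookup_add algebra_simps sum.distrib)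
qed

lemma rep_scale: "rep op (scale c p) \<phi> = (\<lambda>b. c * rep op p \<phi> b)"
proof
  fix b
  have "Poly_Mapping.keys (scale c p) \<subseteq> Poly_Mapping.keys p" by (auto simp: in_keys_iff lookup_scale)
  then show "rep op (scale c p) \<phi> b = c * rep op p \<phi> b"
    by (simp add: rep_superset[of "Poly_Mapping.keys p"] lookup_scale algebra_simps sum_distrib_left)
qed

lemma rep_minus: "rep op (p - q) \<phi> = (\<lambda>b. rep op p \<phi> b - rep op q \<phi> b)"
proof
  fix b
  have "rep op p \<phi> b = rep op ((p - q) + q) \<phi> b" by simp
  also have "\<dots> = rep op (p - q) \<phi> b + rep op q \<phi> b" by (simp only: rep_add)
  finally show "rep op (p - q) \<phi> b = rep op p \<phi> b - rep op q \<phi> b" by simp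
qed

lemma rep_sum: "rep op (sum f A) \<phi> = (\<lambda>b. \<Sum>a\<in>A. rep op (f a) \<phi> b)"
  by (induction A rule: infinite_finite_induct) (simp_all add: rep_zero rep_add)

lemma rep_single: "rep op (Poly_Mapping.single w c) \<phi> = (\<lambda>b. c * foldr op w \<phi> b)"
  by (auto simp: rep_def fun_eq_iff)

lemma rep_gen: "rep op (gen g) \<phi> = op g \<phi>"
  by (simp add: gen_def rep_single)

definition lin_op :: "(('b \<Rightarrow> 'k::field) \<Rightarrow> 'b \<Rightarrow> 'k) \<Rightarrow> bool" where
  "lin_op h \<longleftrightarrow> (\<forall>\<phi> \<psi>. h (\<lambda>x. \<phi> x + \<psi> x) = (\<lambda>x. h \<phi> x + h \<psi> x)) \<and>
     (\<forall>c \<phi>. h (\<lambda>x. c * \<phi> x) = (\<lambda>x. c * h \<phi> x))"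

lemma lin_op_add: "lin_op h \<Longrightarrow> h (\<lambda>x. \<phi> x + \<psi> x) = (\<lambda>x. h \<phi> x + h \<psi> x)"
  unfolding lin_op_def by blast

lemma lin_op_scale: "lin_op h \<Longrightarrow> h (\<lambda>x. c * \<phi> x) = (\<lambda>x. c * h \<phi> x)"
  unfolding lin_op_def by blast

lemma lin_op_zero: "lin_op h \<Longrightarrow> h (\<lambda>x. 0) = (\<lambda>x. 0)"
  using lin_op_scale[of h 0 "\<lambda>x. 0"] by simp

lemma lin_opI:
  assumes "\<And>\<phi> \<psi> b. h (\<lambda>x. \<phi> x + \<psi> x) b = h \<phi> b + h \<psi> b"
    and "\<And>c \<phi> b. h (\<lambda>x. c * \<phi> x) b = c * h \<phi> b"
  shows "lin_op h"
  unfolding lin_op_def by (intro conjI allI ext) (simp_all only: assms)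

lemma lin_op_foldr:
  assumes "\<And>g. lin_op (op g)"
  shows "lin_op (foldr op w)"
proof (induction w)
  case Nil
  show ?case by (rule lin_opI) simp_all
next
  case (Cons g w)
  show ?case
    by (rule lin_opI) (simp_all add: lin_op_add[OF Cons] lin_op_scale[OF Cons]
        lin_op_add[OF assms] lin_op_scale[OF assms])
qed

lemma lin_op_rep:
  assumes "\<And>g. lin_op (op g)"
  shows "lin_op (rep op p)"
proof (rule lin_opI)
  note lin = lin_op_foldr[of op, OF assms]
  fix \<phi> \<psi> :: "'b \<Rightarrow> 'c" and c b
  show "rep op p (\<lambda>x. \<phi> x + \<psi> x) b = rep op p \<phi> b + rep op p \<psi> b"
    by (simp add: rep_def lin_op_add[OF lin] algebra_simps sum.distrib)
  show "rep op p (\<lambda>x. c * \<phi> x) b = c * rep op p \<phi> b"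
    by (simp add: rep_def lin_op_scale[OF lin] sum_distrib_left algebra_simps)
qed

lemma lin_op_sum:
  assumes "lin_op h"
  shows "h (\<lambda>x. \<Sum>a\<in>A. c a * f a x) = (\<lambda>x. \<Sum>a\<in>A. c a * h (f a) x)"
proof (induction A rule: infinite_finite_induct)
  case (insert a A)
  then show ?case
    using lin_op_add[OF assms, of "\<lambda>x. c a * f a x" "\<lambda>x. \<Sum>a\<in>A. c a * f a x"]
    by (simp add: lin_op_scale[OF assms])
qed (simp_all add: lin_op_zero[OF assms])

lemma rep_mult:
  assumes lin: "\<And>g. lin_op (op g)"
  shows "rep op (p * q) \<phi> = rep op p (rep op q \<phi>)"
proof (induction p rule: ncpoly_induct)
  case zero
  then show ?case by (simp add: rep_zero)
next
  case (add p p')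
  then show ?case by (simp add: rep_add distrib_right)
next
  case (single w c)
  show ?case
  proof (induction q rule: ncpoly_induct)
    case zero
    then show ?case using lin_op_zero[OF lin_op_rep[of op, OF lin]] by (simp add: rep_zero)
  next
    case (add q q')
    let ?r = "rep op (Poly_Mapping.single w c)"
    have "rep op (Poly_Mapping.single w c * (q + q')) \<phi>
        = (\<lambda>b. ?r (rep op q \<phi>) b + ?r (rep op q' \<phi>) b)"
      by (simp only: distrib_left rep_add add)
    also have "\<dots> = ?r (rep op (q + q') \<phi>)"
      unfolding rep_add by (rule lin_op_add[OF lin_op_rep[of op, OF lin], symmetric])
    finally show ?case .
  next
    case (single w' c')
    have "foldr op w (\<lambda>b. c' * foldr op w' \<phi> b) = (\<lambda>b. c' * foldr op w (foldr op w' \<phi>) b)"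
      by (rule lin_op_scale[OF lin_op_foldr[of op, OF lin]])
    then show ?case
      by (simp only: mult_single rep_single plus_list_def mult.assoc foldr_append comp_def)
  qed
qed

text \<open>
  Since \<^const>\<open>rep\<close> is multiplicative, the elements acting as zero form a two-sided ideal, so it
  suffices to test the relators.
\<close>

lemma rep_annihilates_gen_ideal:
  assumes lin: "\<And>g. lin_op (op g)"
    and "\<And>r \<phi>. r \<in> R \<Longrightarrow> rep op r \<phi> = (\<lambda>b. 0)"
    and "p \<in> gen_ideal S R"
  shows "rep op p \<phi> = (\<lambda>b. 0)"
  using assms(3)
proof (induction arbitrary: \<phi>)
  case (base p)
  then show ?case by (rule assms(2))
next
  case zero
  then show ?case by (rule rep_zero)
next
  case (add p q)
  then show ?case by (simp add: rep_add)
next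
  case (scale p c)
  then show ?case by (simp add: rep_scale)
next
  case (mult_left f p)
  then show ?case
    by (simp add: rep_mult[of op, OF lin] lin_op_zero[OF lin_op_rep[of op, OF lin]])
next
  case (mult_right p f)
  then show ?case by (simp add: rep_mult[of op, OF lin])
qed

section \<open>Isomorphisms of algebras without matrix_unit\<close>

definition op_closed :: "('k, 'a) nu_algebra \<Rightarrow> bool" where
  "op_closed A \<longleftrightarrow> (\<forall>x \<in> carrier A. \<forall>y \<in> carrier A. alg_add A x y \<in> carrier A \<and> alg_mult A x y \<in> carrier A)
     \<and> (\<forall>c. \<forall>x \<in> carrier A. alg_smult A c x \<in> carrier A)"

text \<open>
  Closure of the source is what lets \<open>h\<close> be cancelled: injectivity of \<open>h\<close> is available on the
  carrier only.
\<close>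

lemma alg_iso_inv:
  assumes "op_closed A" "alg_iso A B h"
  shows "alg_iso B A (inv_into (carrier A) h)"
proof -
  let ?g = "inv_into (carrier A) h"
  have bij: "bij_betw h (carrier A) (carrier B)" using assms(2) by (simp add: alg_iso_def)
  have g: "?g y \<in> carrier A" "h (?g y) = y" if "y \<in> carrier B" for y
    using that bij_betwE[OF bij_betw_inv_into[OF bij]] bij_betw_inv_into_right[OF bij] by auto
  have gh: "?g (h x) = x" if "x \<in> carrier A" for x
    using bij_betw_inv_into_left[OF bij that] .
  show ?thesis
    unfolding alg_iso_def
  proof (intro conjI ballI allI bij_betw_inv_into[OF bij])
    fix x y assume xy: "x \<in> carrier B" "y \<in> carrier B"
    have "h (alg_add A (?g x) (?g y)) = alg_add B x y" "alg_add A (?g x) (?g y) \<in> carrier A"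
      using assms g xy by (simp_all add: alg_iso_def op_closed_def)
    then show "?g (alg_add B x y) = alg_add A (?g x) (?g y)" using gh by metis
    have "h (alg_mult A (?g x) (?g y)) = alg_mult B x y" "alg_mult A (?g x) (?g y) \<in> carrier A"
      using assms g xy by (simp_all add: alg_iso_def op_closed_def)
    then show "?g (alg_mult B x y) = alg_mult A (?g x) (?g y)" using gh by metis
  next
    fix c x assume x: "x \<in> carrier B"
    have "h (alg_smult A c (?g x)) = alg_smult B c x" "alg_smult A c (?g x) \<in> carrier A"
      using assms g x by (simp_all add: alg_iso_def op_closed_def)
    then show "?g (alg_smult B c x) = alg_smult A c (?g x)" using gh by metis
  qed
qed

lemma alg_isomorphic_sym: "op_closed A \<Longrightarrow> A \<cong>\<^sub>a B \<Longrightarrow> B \<cong>\<^sub>a A"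
  using alg_iso_inv unfolding alg_isomorphic_def by blast

lemma alg_isomorphic_trans:
  assumes "A \<cong>\<^sub>a B" "B \<cong>\<^sub>a C"
  shows "A \<cong>\<^sub>a C"
proof -
  obtain h g where h: "alg_iso A B h" and g: "alg_iso B C g"
    using assms unfolding alg_isomorphic_def by blast
  have "h x \<in> carrier B" if "x \<in> carrier A" for x
    using h that by (auto simp: alg_iso_def dest: bij_betwE)
  then have "alg_iso A C (g \<circ> h)"
    using h g unfolding alg_iso_def by (auto intro: bij_betw_trans)
  then show ?thesis unfolding alg_isomorphic_def by blast
qed

text \<open>
  Preservation of the zero is not part of \<^const>\<open>alg_iso\<close>. It follows from compatibility with
  scalars when multiplication by the scalar zero gives the zero vector.
\<close>

lemma finite_dim_iso:
  assumes iso: "alg_iso A B h" and cl: "op_closed A"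
    and zA: "alg_zero A \<in> carrier A" "alg_smult A 0 (alg_zero A) = alg_zero A"
    and zB: "\<And>y. y \<in> carrier B \<Longrightarrow> alg_smult B 0 y = alg_zero B"
    and fd: "alg_finite_dim A"
  shows "alg_finite_dim B"
proof -
  obtain T where T: "finite T" "T \<subseteq> carrier A" "alg_span A T = carrier A"
    using fd unfolding alg_finite_dim_def by blast
  have bij: "bij_betw h (carrier A) (carrier B)" using iso by (simp add: alg_iso_def)
  have "h (alg_smult A 0 (alg_zero A)) = alg_smult B 0 (h (alg_zero A))"
    using iso zA(1) by (simp add: alg_iso_def)
  then have z: "alg_zero A \<in> carrier A" "h (alg_zero A) = alg_zero B"
    using zA zB bij_betwE[OF bij] by simp_all
  have 1: "x \<in> alg_span A T \<Longrightarrow> h x \<in> alg_span B (h ` T)" for x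
  proof (induction rule: alg_span.induct)
    case zero
    then show ?case using alg_span.zero[of B] z by simp
  next
    case (step x b c)
    have "b \<in> carrier A" "x \<in> carrier A" using step T by auto
    moreover from this have "alg_smult A c b \<in> carrier A" using cl by (simp add: op_closed_def)
    ultimately have "h (alg_add A x (alg_smult A c b)) = alg_add B (h x) (alg_smult B c (h b))"
      using iso by (simp add: alg_iso_def)
    then show ?case using step alg_span.step[of "h x" B "h ` T"] by auto
  qed
  have 2: "y \<in> alg_span B (h ` T) \<Longrightarrow> y \<in> h ` carrier A" for y
  proof (induction rule: alg_span.induct)
    case zero
    then show ?case using z by force
  next
    case (step y b c)
    then obtain x t where x: "x \<in> carrier A" "y = h x" "t \<in> T" "b = h t" by auto
    then have t: "t \<in> carrier A" using T by auto
    then have "alg_smult A c t \<in> carrier A" "alg_add A x (alg_smult A c t) \<in> carrier A"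
      using cl x by (simp_all add: op_closed_def)
    moreover from this have "h (alg_add A x (alg_smult A c t)) = alg_add B y (alg_smult B c b)"
      using iso x t by (simp add: alg_iso_def)
    ultimately show ?case by (metis image_eqI)
  qed
  have img: "h ` carrier A = carrier B" using bij by (simp add: bij_betw_def)
  have "carrier B \<subseteq> alg_span B (h ` T)"
  proof
    fix y assume "y \<in> carrier B"
    then obtain x where "x \<in> carrier A" "y = h x" using img by blast
    then show "y \<in> alg_span B (h ` T)" using 1[of x] T(3) by simp
  qed
  moreover have "alg_span B (h ` T) \<subseteq> carrier B" using 2 img by blast
  ultimately have "alg_span B (h ` T) = carrier B" by (rule equalityI[rotated])
  moreover have "h ` T \<subseteq> carrier B" using T(2) img by blast
  moreover have "finite (h ` T)" using T(1) by (rule finite_imageI)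
  ultimately show ?thesis unfolding alg_finite_dim_def by blast
qed

section \<open>Presented algebras\<close>

lemma single_Nil_mult: "Poly_Mapping.single [] c * p = scale c p"
  for p :: "('g, 'k::comm_ring_1) ncpoly"
proof (induction p rule: ncpoly_induct)
  case zero
  show ?case by (simp add: poly_mapping_eq_iff fun_eq_iff lookup_scale)
next
  case (single w d)
  show ?case
    by (rule poly_mapping_eqI) (simp add: mult_single plus_list_def lookup_scale lookup_single when_def)
next
  case (add p q)
  then show ?case by (simp add: distrib_left scale_add_right)
qed

lemma mult_single_Nil: "p * Poly_Mapping.single [] c = scale c p"
  for p :: "('g, 'k::comm_ring_1) ncpoly"
proof (induction p rule: ncpoly_induct)
  case zero
  show ?case by (simp add: poly_mapping_eq_iff fun_eq_iff lookup_scale)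
next
  case (single w d)
  show ?case
    by (rule poly_mapping_eqI) (simp add: mult_single plus_list_def lookup_scale lookup_single
        when_def mult.commute)
next
  case (add p q)
  then show ?case by (simp add: distrib_right scale_add_right)
qed

lemma mult_scale_right: "p * scale c q = scale c (p * q)"
  for p :: "('g, 'k::comm_ring_1) ncpoly"
  by (simp only: mult_single_Nil[symmetric] mult.assoc)

lemma scale_zero_left: "scale 0 p = 0"
  by (rule poly_mapping_eqI) (simp add: lookup_scale)

lemma gen_mult_single: "gen g * Poly_Mapping.single w c = Poly_Mapping.single (g # w) c"
  by (simp add: gen_def mult_single plus_list_def)

text \<open>
  Paths of length zero correspond to the empty word, which \<^const>\<open>free_alg\<close> excludes. The ideal
  generated inside \<^const>\<open>free_alg\<close> is nevertheless closed under multiplication by polynomials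
  that may contain the empty word, so products of paths can be handled without a case distinction.
\<close>

definition unital_free_alg :: "'g set \<Rightarrow> ('g, 'k::comm_ring_1) ncpoly set" where
  "unital_free_alg S = {p. Poly_Mapping.keys p \<subseteq> lists S}"

lemma unital_single: "w \<in> lists S \<Longrightarrow> Poly_Mapping.single w c \<in> unital_free_alg S"
  by (auto simp: unital_free_alg_def)

lemma unital_gen: "g \<in> S \<Longrightarrow> gen g \<in> unital_free_alg S"
  by (simp add: gen_def unital_single)

lemma unital_if_free: "p \<in> free_alg S \<Longrightarrow> p \<in> unital_free_alg S"
  by (auto simp: unital_free_alg_def free_alg_def)

lemma unital_mult: "p \<in> unital_free_alg S \<Longrightarrow> q \<in> unital_free_alg S \<Longrightarrow> p * q \<in> unital_free_alg S"
  using keys_mult[of p q] by (fastforce simp: unital_free_alg_def plus_list_def)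

lemma free_alg_unital_left: "p \<in> unital_free_alg S \<Longrightarrow> q \<in> free_alg S \<Longrightarrow> p * q \<in> free_alg S"
  using keys_mult[of p q] by (fastforce simp: unital_free_alg_def free_alg_def plus_list_def)

lemma free_alg_unital_right: "p \<in> free_alg S \<Longrightarrow> q \<in> unital_free_alg S \<Longrightarrow> p * q \<in> free_alg S"
  using keys_mult[of p q] by (fastforce simp: unital_free_alg_def free_alg_def plus_list_def)

lemma single_in_free_alg: "w \<in> lists S \<Longrightarrow> w \<noteq> [] \<Longrightarrow> Poly_Mapping.single w c \<in> free_alg S"
  by (auto simp: free_alg_def)

lemma gen_ideal_unital_left:
  assumes "f \<in> unital_free_alg S" "p \<in> gen_ideal S R"
  shows "f * p \<in> gen_ideal S R"
proof (induction f rule: ncpoly_induct)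
  case zero
  then show ?case by (simp add: gen_ideal.zero)
next
  case (single w c)
  then have "w \<in> lists S" using assms(1) by (auto simp: unital_free_alg_def)
  then show ?case
    by (cases "w = []")
      (auto simp: single_Nil_mult intro: gen_ideal.scale gen_ideal.mult_left single_in_free_alg assms)
next
  case (add p q)
  then show ?case by (simp add: distrib_right gen_ideal.add)
qed

lemma gen_ideal_unital_right:
  assumes "f \<in> unital_free_alg S" "p \<in> gen_ideal S R"
  shows "p * f \<in> gen_ideal S R"
proof (induction f rule: ncpoly_induct)
  case zero
  then show ?case by (simp add: gen_ideal.zero)
next
  case (single w c)
  then have "w \<in> lists S" using assms(1) by (auto simp: unital_free_alg_def)
  then show ?case
    by (cases "w = []")
      (auto simp: mult_single_Nil intro: gen_ideal.scale gen_ideal.mult_right single_in_free_alg assms)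
next
  case (add p q)
  then show ?case by (simp add: distrib_left gen_ideal.add)
qed

definition ideal_cong :: "'g set \<Rightarrow> ('g, 'k::comm_ring_1) ncpoly set
    \<Rightarrow> ('g, 'k) ncpoly \<Rightarrow> ('g, 'k) ncpoly \<Rightarrow> bool" where
  "ideal_cong S R p q \<longleftrightarrow> p - q \<in> gen_ideal S R"

lemma ideal_cong_refl: "ideal_cong S R p p"
  by (simp add: ideal_cong_def gen_ideal.zero)

lemma ideal_cong_sym: "ideal_cong S R p q \<Longrightarrow> ideal_cong S R q p"
  using gen_ideal_uminus[of "p - q" S R] by (simp add: ideal_cong_def)

lemma ideal_cong_trans [trans]: "ideal_cong S R p q \<Longrightarrow> ideal_cong S R q r \<Longrightarrow> ideal_cong S R p r"
  using gen_ideal.add[of "p - q" S R "q - r"] by (simp add: ideal_cong_def)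

lemma ideal_cong_add: "ideal_cong S R p q \<Longrightarrow> ideal_cong S R p' q' \<Longrightarrow> ideal_cong S R (p + p') (q + q')"
  using gen_ideal.add[of "p - q" S R "p' - q'"] by (simp add: ideal_cong_def algebra_simps)

lemma ideal_cong_diff: "ideal_cong S R p q \<Longrightarrow> ideal_cong S R p' q' \<Longrightarrow> ideal_cong S R (p - p') (q - q')"
  using gen_ideal.add[of "p - q" S R "- (p' - q')"] gen_ideal_uminus[of "p' - q'" S R]
  by (simp add: ideal_cong_def algebra_simps)

lemma ideal_cong_sum: "(\<And>x. x \<in> A \<Longrightarrow> ideal_cong S R (f x) (g x)) \<Longrightarrow> ideal_cong S R (sum f A) (sum g A)"
  by (induction A rule: infinite_finite_induct) (auto intro: ideal_cong_refl ideal_cong_add)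

lemma ideal_cong_left: "ideal_cong S R p q \<Longrightarrow> f \<in> unital_free_alg S \<Longrightarrow> ideal_cong S R (f * p) (f * q)"
  using gen_ideal_unital_left[of f S "p - q" R] by (simp add: ideal_cong_def algebra_simps)

lemma ideal_cong_right: "ideal_cong S R p q \<Longrightarrow> f \<in> unital_free_alg S \<Longrightarrow> ideal_cong S R (p * f) (q * f)"
  using gen_ideal_unital_right[of f S "p - q" R] by (simp add: ideal_cong_def algebra_simps)

text \<open>
  The first isomorphism theorem for presented algebras. The isomorphism evaluates \<open>\<Phi>\<close> at an
  arbitrary representative of a coset.
\<close>

lemma presented_alg_iso:
  fixes R :: "('g, 'k::comm_ring_1) ncpoly set"
  assumes R: "R \<subseteq> free_alg S"
    and ker: "\<And>x y. x \<in> free_alg S \<Longrightarrow> y \<in> free_alg S \<Longrightarrow> x - y \<in> gen_ideal S R \<longleftrightarrow> \<Phi> x = \<Phi> y"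
    and img: "\<Phi> ` free_alg S = carrier B"
    and add: "\<And>x y. x \<in> free_alg S \<Longrightarrow> y \<in> free_alg S \<Longrightarrow> \<Phi> (x + y) = alg_add B (\<Phi> x) (\<Phi> y)"
    and mult: "\<And>x y. x \<in> free_alg S \<Longrightarrow> y \<in> free_alg S \<Longrightarrow> \<Phi> (x * y) = alg_mult B (\<Phi> x) (\<Phi> y)"
    and scale: "\<And>c x. x \<in> free_alg S \<Longrightarrow> \<Phi> (scale c x) = alg_smult B c (\<Phi> x)"
  shows "presented_alg S R \<cong>\<^sub>a B"
proof -
  let ?A = "presented_alg S R" and ?c = "coset (gen_ideal S R)"
  define h where "h P = \<Phi> (SOME p. p \<in> P)" for P
  have h: "h (?c p) = \<Phi> p" if p: "p \<in> free_alg S" for p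
  proof -
    have "(SOME q. q \<in> ?c p) \<in> ?c p" by (rule someI[of _ p]) (rule coset_self)
    then obtain i where i: "i \<in> gen_ideal S R" "(SOME q. q \<in> ?c p) = p + i"
      by (auto simp: coset_def)
    then have "p + i \<in> free_alg S" using gen_ideal_subset[OF R] p by (blast intro: free_alg_add)
    then have "\<Phi> (p + i) = \<Phi> p" using ker[of "p + i" p] p i by simp
    then show ?thesis by (simp add: h_def i)
  qed
  have carrier: "carrier ?A = ?c ` free_alg S" by (simp add: presented_alg_def Let_def)
  have "bij_betw h (carrier ?A) (carrier B)"
    unfolding bij_betw_def
  proof
    show "inj_on h (carrier ?A)"
    proof (rule inj_onI)
      fix P Q assume "P \<in> carrier ?A" "Q \<in> carrier ?A" and eq: "h P = h Q"
      then obtain p q where pq: "p \<in> free_alg S" "P = ?c p" "q \<in> free_alg S" "Q = ?c q"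
        unfolding carrier by blast
      then have "p - q \<in> gen_ideal S R" using eq ker by (simp add: h)
      then show "P = Q" unfolding pq by (rule coset_eqI)
    qed
    show "h ` carrier ?A = carrier B"
      unfolding carrier img[symmetric] image_image by (rule image_cong) (simp_all add: h)
  qed
  then have "alg_iso ?A B h"
    unfolding alg_iso_def carrier
    by (auto simp: presented_alg_add presented_alg_mult[OF R] presented_alg_smult h
        free_alg_add free_alg_mult free_alg_scale add mult scale)
  then show ?thesis unfolding alg_isomorphic_def by blast
qed

lemma op_closed_presented_alg:
  assumes "R \<subseteq> free_alg S"
  shows "op_closed (presented_alg S R)"
proof -
  have "carrier (presented_alg S R) = coset (gen_ideal S R) ` free_alg S"
    by (simp add: presented_alg_def Let_def)
  then show ?thesis
    unfolding op_closed_def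
    by (auto simp: presented_alg_add presented_alg_mult[OF assms] presented_alg_smult
        intro!: imageI free_alg_add free_alg_mult free_alg_scale)
qed

section \<open>Branching systems\<close>

text \<open>
  A set \<open>B\<close> of abstract paths on which the arcs act by prepending: \<open>pre e\<close> is an injection of the
  paths starting at \<open>head G e\<close> into those starting at \<open>tail G e\<close>, different arcs have disjoint
  images, and at a vertex of \<open>X\<close> the images of the outgoing arcs exhaust everything. The last
  condition is exactly what the relation \<open>XCK2\<close> demands, so every such system carries a
  representation of the Cohn path algebra. Two of them are used: one that exists for every graph
  and is large enough to separate all walks, and the walks ending outside \<open>X\<close>, which yield the
  matrix form of the algebra.
\<close>

locale branching_system = wf_digraph G for G :: "('v, 'e) pre_digraph" +
  fixes X :: "'v set" and B :: "'b set" and src :: "'b \<Rightarrow> 'v" and pre :: "'e \<Rightarrow> 'b \<Rightarrow> 'b"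
  assumes X_regular: "X \<subseteq> regular_verts G"
    and pre_in: "\<lbrakk>e \<in> arcs G; b \<in> B; src b = head G e\<rbrakk> \<Longrightarrow> pre e b \<in> B"
    and src_pre: "\<lbrakk>e \<in> arcs G; b \<in> B; src b = head G e\<rbrakk> \<Longrightarrow> src (pre e b) = tail G e"
    and pre_inj: "\<lbrakk>e \<in> arcs G; f \<in> arcs G; b \<in> B; c \<in> B; src b = head G e; src c = head G f;
        pre e b = pre f c\<rbrakk> \<Longrightarrow> e = f \<and> b = c"
    and pre_surj: "\<lbrakk>b \<in> B; src b \<in> X\<rbrakk>
        \<Longrightarrow> \<exists>e \<in> out_arcs G (src b). \<exists>c \<in> B. src c = head G e \<and> b = pre e c"
begin

definition starts_with :: "'e \<Rightarrow> 'b \<Rightarrow> 'b \<Rightarrow> bool" where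
  "starts_with e b c \<longleftrightarrow> e \<in> arcs G \<and> c \<in> B \<and> src c = head G e \<and> b = pre e c"

text \<open>
  An edge removes itself from the front of its argument before the function is evaluated, and a
  ghost edge prepends itself; equivalently, on indicator functions of paths an edge prepends and a
  ghost edge removes, see \<open>act_Edge_point\<close>.
\<close>

primrec act :: "('v, 'e) cohn_gen \<Rightarrow> ('b \<Rightarrow> 'k::field) \<Rightarrow> 'b \<Rightarrow> 'k" where
  "act (Vert v) \<phi> = (\<lambda>b. if b \<in> B \<and> src b = v then \<phi> b else 0)"
| "act (Edge e) \<phi> = (\<lambda>b. if \<exists>c. starts_with e b c then \<phi> (THE c. starts_with e b c) else 0)"
| "act (Ghost e) \<phi> = (\<lambda>b. if e \<in> arcs G \<and> b \<in> B \<and> src b = head G e then \<phi> (pre e b) else 0)"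

lemma starts_with_unique: "starts_with e b c \<Longrightarrow> starts_with f b d \<Longrightarrow> e = f \<and> c = d"
  using pre_inj unfolding starts_with_def by metis

lemma starts_with_in: "starts_with e b c \<Longrightarrow> b \<in> B \<and> src b = tail G e"
  using pre_in src_pre unfolding starts_with_def by metis

lemma act_Edge_eq: "starts_with e b c \<Longrightarrow> act (Edge e) \<phi> b = \<phi> c"
  using starts_with_unique by (auto intro!: arg_cong[of _ _ \<phi>])

lemma act_Edge_eq_0: "(\<And>c. \<not> starts_with e b c) \<Longrightarrow> act (Edge e) \<phi> b = 0"
  by auto

lemma lin_op_act: "lin_op (act g :: ('b \<Rightarrow> 'k::field) \<Rightarrow> 'b \<Rightarrow> 'k)"
  by (cases g) (auto intro!: lin_opI)

lemmas rep_act_mult = rep_mult[of act, OF lin_op_act]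

lemma rep_act_gen_gen: "rep act (gen g * gen h) \<phi> = act g (act h \<phi>)"
  by (simp only: rep_act_mult rep_gen)

lemma act_Edge_Ghost:
  "act (Edge e) (act (Ghost e) \<phi>) b = (if \<exists>c. starts_with e b c then \<phi> b else 0)"
proof (cases "\<exists>c. starts_with e b c")
  case True
  then obtain c where c: "starts_with e b c" by blast
  then show ?thesis
    using True unfolding act_Edge_eq[OF c] by (auto simp: starts_with_def)
qed (auto)

text \<open>
  The operator \<open>e e\<^sup>*\<close> is the projection onto the paths beginning with \<open>e\<close>, and a path begins with
  at most one arc.
\<close>

lemma sum_act_Edge_Ghost:
  assumes "finite (out_arcs G v)"
  shows "(\<Sum>e\<in>out_arcs G v. act (Edge e) (act (Ghost e) \<phi>) b)
    = (if \<exists>e\<in>out_arcs G v. \<exists>c. starts_with e b c then \<phi> b else 0)"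
proof (cases "\<exists>e\<in>out_arcs G v. \<exists>c. starts_with e b c")
  case True
  then obtain e c where e: "e \<in> out_arcs G v" "starts_with e b c" by blast
  have "act (Edge f) (act (Ghost f) \<phi>) b = (if f = e then \<phi> b else 0)" for f
    unfolding act_Edge_Ghost using e starts_with_unique by auto
  then have "(\<Sum>f\<in>out_arcs G v. act (Edge f) (act (Ghost f) \<phi>) b) = \<phi> b"
    using assms e(1) by (simp del: act.simps)
  with True show ?thesis by simp
next
  case False
  then show ?thesis by (auto simp del: act.simps simp: act_Edge_Ghost)
qed

text \<open>
  Each relation is a combinatorial property of prepending: \<open>CK1\<close> is injectivity together with
  disjointness of images, and \<open>XCK2\<close> is the exhaustion of the paths from a vertex of \<open>X\<close>.
\<close>

lemma rep_relator:
  assumes "r \<in> cohn_relators G X"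
  shows "rep act r \<phi> = (\<lambda>b. 0::'k::field)"
  using assms
proof cases
  case (V v w)
  then show ?thesis by (auto simp: rep_minus rep_act_gen_gen rep_gen rep_zero fun_eq_iff)
next
  case (E1_source e)
  have "act (Vert (tail G e)) (act (Edge e) \<phi>) b = act (Edge e) \<phi> b" for b
    by (auto dest: starts_with_in)
  with E1_source show ?thesis by (simp only: rep_minus rep_act_gen_gen rep_gen) simp
next
  case (E1_range e)
  have "act (Edge e) (act (Vert (head G e)) \<phi>) b = act (Edge e) \<phi> b" for b
  proof (cases "\<exists>c. starts_with e b c")
    case True
    then obtain c where c: "starts_with e b c" by blast
    then show ?thesis unfolding act_Edge_eq[OF c] by (simp add: starts_with_def)
  qed auto
  with E1_range show ?thesis by (simp only: rep_minus rep_act_gen_gen rep_gen) simp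
next
  case (E2_range e)
  then show ?thesis by (auto simp: rep_minus rep_act_gen_gen rep_gen fun_eq_iff)
next
  case (E2_source e)
  then show ?thesis
    using pre_in src_pre by (auto simp: rep_minus rep_act_gen_gen rep_gen fun_eq_iff)
next
  case (CK1 e f)
  have "act (Ghost e) (act (Edge f) \<phi>) b = (if e = f then act (Vert (head G e)) \<phi> b else 0)" for b
  proof (cases "b \<in> B \<and> src b = head G e")
    case True
    then have b: "starts_with e (pre e b) b" using CK1 by (simp add: starts_with_def)
    show ?thesis
    proof (cases "e = f")
      case True
      then show ?thesis using b \<open>b \<in> B \<and> src b = head G e\<close> CK1 act_Edge_eq[OF b, of \<phi>]
        by (simp del: act.simps(2))
    next
      case False
      then have "\<not> starts_with f (pre e b) c" for c using starts_with_unique[OF b] by blast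
      then have "act (Edge f) \<phi> (pre e b) = 0" by (intro act_Edge_eq_0)
      then show ?thesis using False by (simp del: act.simps(2))
    qed
  qed auto
  with CK1 show ?thesis
    by (cases "e = f")
      (simp_all only: rep_minus rep_act_gen_gen rep_gen rep_zero simp_thms if_True if_False, simp_all)
next
  case (XCK2 v)
  then have fin: "finite (out_arcs G v)" using X_regular by (auto simp: regular_verts_def)
  have "act (Vert v) \<phi> b = (\<Sum>e\<in>out_arcs G v. act (Edge e) (act (Ghost e) \<phi>) b)" for b
  proof (cases "b \<in> B \<and> src b = v")
    case True
    then have "\<exists>e\<in>out_arcs G v. \<exists>c. starts_with e b c"
      using pre_surj[of b] XCK2 by (auto simp: starts_with_def)
    with True show ?thesis unfolding sum_act_Edge_Ghost[OF fin] by simp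
  next
    case False
    then have "\<not> (\<exists>e\<in>out_arcs G v. \<exists>c. starts_with e b c)"
      by (auto dest: starts_with_in)
    with False show ?thesis unfolding sum_act_Edge_Ghost[OF fin] by auto
  qed
  with XCK2 show ?thesis
    by (simp only: rep_minus rep_sum rep_act_gen_gen rep_gen) simp
qed

lemma rep_act_gen_ideal:
  "p \<in> gen_ideal S (cohn_relators G X) \<Longrightarrow> rep act p \<phi> = (\<lambda>b. 0::'k::field)"
  by (rule rep_annihilates_gen_ideal[of act "cohn_relators G X"])
    (use lin_op_act rep_relator in blast)+

lemma act_Edge_point:
  assumes "e \<in> arcs G" "b \<in> B" "src b = head G e"
  shows "act (Edge e) (point b) = (point (pre e b) :: 'b \<Rightarrow> 'k::field)"
proof
  fix d
  show "act (Edge e) (point b) d = (point (pre e b) d :: 'k)"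
  proof (cases "\<exists>c. starts_with e d c")
    case True
    then obtain c where c: "starts_with e d c" by blast
    have "c = b \<longleftrightarrow> d = pre e b"
      using c assms pre_inj unfolding starts_with_def by metis
    then show ?thesis unfolding act_Edge_eq[OF c] by (simp add: point_def)
  next
    case False
    with assms have "d \<noteq> pre e b" by (auto simp: starts_with_def)
    with False show ?thesis by (simp add: point_def)
  qed
qed

lemma foldr_pre:
  assumes "awalk u p v" "b \<in> B" "src b = v"
  shows "foldr pre p b \<in> B \<and> src (foldr pre p b) = u"
  using assms
proof (induction p arbitrary: u)
  case Nil
  then show ?case by (auto simp: awalk_Nil_iff)
next
  case (Cons e p)
  then show ?case using pre_in src_pre by (auto simp: awalk_Cons_iff)
qed

lemma foldr_act_Edge_point:
  assumes "awalk u p v" "b \<in> B" "src b = v"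
  shows "foldr act (map Edge p) (point b) = (point (foldr pre p b) :: 'b \<Rightarrow> 'k::field)"
  using assms
proof (induction p arbitrary: u)
  case (Cons e p)
  then have p: "awalk (head G e) p v" "e \<in> arcs G" by (auto simp: awalk_Cons_iff)
  then have IH: "foldr act (map Edge p) (point b) = (point (foldr pre p b) :: 'b \<Rightarrow> 'k)"
    using Cons by blast
  have "act (Edge e) (point (foldr pre p b)) = (point (foldr pre (e # p) b) :: 'b \<Rightarrow> 'k)"
    using act_Edge_point[of e "foldr pre p b"] p foldr_pre[OF p(1) Cons.prems(2,3)] by simp
  then show ?case by (simp add: IH del: act.simps)
qed simp

end

section \<open>Finite dimension forces finitely many walks\<close>

text \<open>
  A linear map that kills the ideal factors through the quotient. If the quotient is finitely
  spanned, so is the image of the map, which then contains only finitely many indicator functions.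
\<close>

lemma finite_if_points_represented:
  fixes R :: "('g, 'k::field) ncpoly set" and f :: "('g, 'k) ncpoly \<Rightarrow> 'b \<Rightarrow> 'k"
  assumes fd: "alg_finite_dim (presented_alg S R)"
    and zero: "f 0 = (\<lambda>b. 0)" and add: "\<And>p q. f (p + q) = (\<lambda>b. f p b + f q b)"
    and scale: "\<And>c p. f (scale c p) = (\<lambda>b. c * f p b)"
    and ideal: "\<And>p. p \<in> gen_ideal S R \<Longrightarrow> f p = (\<lambda>b. 0)"
    and points: "\<And>b. b \<in> D \<Longrightarrow> \<exists>p \<in> free_alg S. f p = point b"
  shows "finite D"
proof -
  let ?A = "presented_alg S R" and ?c = "coset (gen_ideal S R)"
  obtain T where T: "finite T" "T \<subseteq> carrier ?A" "alg_span ?A T = carrier ?A"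
    using fd unfolding alg_finite_dim_def by blast
  have carrier: "carrier ?A = ?c ` free_alg S"
    by (simp add: presented_alg_def Let_def)
  have zeroA: "alg_zero ?A = ?c 0"
    by (simp add: presented_alg_def Let_def)
  from T(2) carrier have "\<forall>P\<in>T. \<exists>p. P = ?c p" by auto
  then obtain r where r: "\<And>P. P \<in> T \<Longrightarrow> P = ?c (r P)" by metis
  let ?V = "fun_space.span ((\<lambda>P. f (r P)) ` T)"
  have span: "\<exists>x. P = ?c x \<and> f x \<in> ?V" if "P \<in> alg_span ?A T" for P
    using that
  proof induction
    case zero
    have "f 0 \<in> ?V" using fun_space.span_zero by (simp add: assms(2) zero_fun_def)
    then show ?case using zeroA by blast
  next
    case (step P b c)
    then obtain x where x: "P = ?c x" "f x \<in> ?V" by blast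
    have "alg_add ?A P (alg_smult ?A c b) = ?c (x + scale c (r b))"
      using x(1) r[OF step(2)] by (metis presented_alg_add presented_alg_smult)
    moreover have "f (r b) \<in> ?V" using step(2) by (intro fun_space.span_base) auto
    then have "f x + (\<lambda>y. c * f (r b) y) \<in> ?V"
      using x(2) by (intro fun_space.span_add fun_space.span_scale)
    then have "f (x + scale c (r b)) \<in> ?V"
      unfolding add scale plus_fun_def .
    ultimately show ?case by blast
  qed
  have "f y \<in> ?V" if "y \<in> free_alg S" for y
  proof -
    have "?c y \<in> alg_span ?A T" using that T(3) carrier by blast
    from span[OF this] obtain x where x: "?c y = ?c x" "f x \<in> ?V" by blast
    have "y \<in> ?c x" using coset_self[of y] x(1) by metis
    then obtain i where i: "y = x + i" "i \<in> gen_ideal S R" by (auto simp: coset_def)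
    then have "f y = f x" by (simp only: add ideal) simp
    with x show ?thesis by simp
  qed
  then have "point b \<in> ?V" if "b \<in> D" for b using points[OF that] by force
  then show "finite D" using card_le_if_points_in_span[of "(\<lambda>P. f (r P)) ` T" D] T(1) by blast
qed

text \<open>
  A fixed numbering of the arcs leaving a vertex, meaningful when these are finitely many.
\<close>

definition enum_arcs :: "('v, 'e) pre_digraph \<Rightarrow> 'v \<Rightarrow> 'e \<Rightarrow> nat" where
  "enum_arcs G v = (SOME h. bij_betw h (out_arcs G v) {0..<card (out_arcs G v)})"

lemma enum_arcs: "finite (out_arcs G v) \<Longrightarrow>
    bij_betw (enum_arcs G v) (out_arcs G v) {0..<card (out_arcs G v)}"
  unfolding enum_arcs_def by (rule someI_ex[OF ex_bij_betw_finite_nat])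

text \<open>
  A branching system on \<open>'v \<times> 'e list \<times> nat \<times> int\<close> that exists for every graph. At a vertex in \<open>X\<close>
  with \<open>m\<close> outgoing arcs, the natural number \<open>k\<close> is replaced by \<open>k m + i\<close> for the arc of number
  \<open>i < m\<close>; by division with remainder this splits the copy of \<open>nat\<close> at the vertex into the \<open>m\<close>
  disjoint images that \<open>XCK2\<close> asks for. At any other vertex the arc is recorded in a list, which
  works for arbitrarily many arcs and needs no exhaustion. The integer counts the length of what
  was prepended. It is what keeps walks of different lengths apart; without it, a power of a cycle
  could act trivially. It has to range over all integers for prepending to remain exhaustive.
\<close>

definition generic_pre :: "('v, 'e) pre_digraph \<Rightarrow> 'v set \<Rightarrow> 'e
    \<Rightarrow> 'v \<times> 'e list \<times> nat \<times> int \<Rightarrow> 'v \<times> 'e list \<times> nat \<times> int" where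
  "generic_pre G X e = (\<lambda>(u, l, k, z). let v = tail G e in
     if v \<in> X then (v, l, k * card (out_arcs G v) + enum_arcs G v e, z + 1)
     else (v, e # l, k, z + 1))"

lemma generic_branching_system:
  assumes "wf_digraph G" "X \<subseteq> regular_verts G"
  shows "branching_system G X UNIV fst (generic_pre G X)"
proof -
  interpret wf_digraph G by fact
  show ?thesis
  proof (unfold_locales, goal_cases)
    case 1
    show ?case by fact
  next
    case (2 e b)
    then show ?case by simp
  next
    case (3 e b)
    then show ?case by (auto simp: generic_pre_def Let_def split: prod.splits)
  next
    case (4 e f b c)
    obtain l k z l' k' z' where bc: "b = (head G e, l, k, z)" "c = (head G f, l', k', z')"
      using 4(5,6) by (cases b, cases c) auto
    have t: "tail G e = tail G f" using 4(7)
      by (auto simp: generic_pre_def Let_def bc split: if_splits)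
    show ?case
    proof (cases "tail G f \<in> X")
      case False
      with 4(7) t show ?thesis by (auto simp: generic_pre_def Let_def bc)
    next
      case True
      let ?m = "card (out_arcs G (tail G f))" and ?h = "enum_arcs G (tail G f)"
      have bij: "bij_betw ?h (out_arcs G (tail G f)) {0..<?m}"
        by (rule enum_arcs) (use True assms(2) in \<open>auto simp: regular_verts_def\<close>)
      have "?h e \<in> {0..<?m}" "?h f \<in> {0..<?m}"
        by (rule bij_betwE[OF bij, rule_format], use 4 t in simp)+
      moreover have eq: "l = l'" "z = z'" "k * ?m + ?h e = k' * ?m + ?h f"
        using 4(7) t True by (auto simp: generic_pre_def Let_def bc)
      ultimately have "?h e < ?m" "?h f < ?m" by simp_all
      then have "?h e = (k * ?m + ?h e) mod ?m" "?h f = (k' * ?m + ?h f) mod ?m"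
        "k = (k * ?m + ?h e) div ?m" "k' = (k' * ?m + ?h f) div ?m" by simp_all
      then have "?h e = ?h f" "k = k'" using eq(3) by metis+
      moreover from this have "e = f"
        using bij_betw_imp_inj_on[OF bij] 4 t by (auto dest: inj_onD)
      ultimately show ?thesis using eq bc by simp
    qed
  next
    case (5 b)
    obtain v l k z where b: "b = (v, l, k, z)" by (cases b)
    with 5 have v: "v \<in> X" by simp
    let ?m = "card (out_arcs G v)" and ?h = "enum_arcs G v"
    have fin: "finite (out_arcs G v)" "out_arcs G v \<noteq> {}"
      using v assms(2) by (auto simp: regular_verts_def)
    then have m: "?m > 0" by (simp add: card_gt_0_iff)
    note bij = enum_arcs[OF fin(1)]
    have "k mod ?m \<in> ?h ` out_arcs G v"
      using bij_betw_imp_surj_on[OF bij] m by simp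
    then obtain e where e: "e \<in> out_arcs G v" "?h e = k mod ?m" by auto
    then have te: "tail G e = v" by simp
    \<comment> \<open>the preimage is found by division with remainder\<close>
    have "b = generic_pre G X e (head G e, l, k div ?m, z - 1)"
      using v by (simp add: generic_pre_def Let_def te b e(2))
    moreover have "fst (head G e, l, k div ?m, z - 1) = head G e" by simp
    moreover have "e \<in> out_arcs G (fst b)" using e(1) b by simp
    ultimately show ?case by blast
  qed
qed

text \<open>
  A walk is stored with both of its ends. Having the source as a component spares a case distinction
  for empty walks, and the target stays unchanged when an arc is put in front.
\<close>

type_synonym ('v, 'e) walk = "'v \<times> 'e list \<times> 'v"

definition walks :: "('v, 'e) pre_digraph \<Rightarrow> ('v, 'e) walk set" where
  "walks G = {(u, p, v). pre_digraph.awalk G u p v}"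

text \<open>
  The walks are linearly independent in the Cohn path algebra over any field: in the generic
  branching system, applied to a function that marks one base point per vertex, different walks give
  indicator functions of different points. Hence a finite-dimensional Cohn path algebra leaves room
  for finitely many walks only.
\<close>

lemma finite_walks_if_finite_dim:
  assumes wf: "wf_digraph G" and X: "X \<subseteq> regular_verts G"
    and fd: "alg_finite_dim (cohn_path_algebra TYPE('k::field) G X)"
  shows "finite (walks G)"
proof -
  interpret branching_system G X UNIV fst "generic_pre G X"
    by (rule generic_branching_system) fact+
  define base :: "'a \<Rightarrow> 'a \<times> 'b list \<times> nat \<times> int" where "base v = (v, [], 0, 0)" for v
  define \<phi> :: "'a \<times> 'b list \<times> nat \<times> int \<Rightarrow> 'k" where "\<phi> b = (if b \<in> range base then 1 else 0)" for b
  let ?pt = "\<lambda>(u, p, v). foldr (generic_pre G X) p (base v)"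
  have \<phi>: "act (Vert v) \<phi> = point (base v)" for v
    by (auto simp: fun_eq_iff \<phi>_def point_def base_def)
  have "finite (?pt ` walks G)"
  proof (rule finite_if_points_represented[of "cohn_gens G" "cohn_relators G X" "\<lambda>p. rep act p \<phi>"])
    show "alg_finite_dim (presented_alg (cohn_gens G) (cohn_relators G X :: (('a,'b) cohn_gen, 'k) ncpoly set))"
      using fd by (simp add: cohn_path_algebra_def)
    fix b assume "b \<in> ?pt ` walks G"
    then obtain u p v where w: "awalk u p v" and b: "b = foldr (generic_pre G X) p (base v)"
      by (auto simp: walks_def)
    let ?w = "map Edge p @ [Vert v]"
    have "v \<in> verts G" using w awlast_in_verts by auto
    then have "Poly_Mapping.single ?w (1::'k) \<in> free_alg (cohn_gens G)"
      using w by (auto simp: free_alg_def cohn_gens_def awalk_def image_iff subset_iff)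
    moreover have "rep act (Poly_Mapping.single ?w (1::'k)) \<phi> = point b"
      using foldr_act_Edge_point[OF w, of "base v"]
      by (simp del: act.simps add: rep_single \<phi> b) (simp add: base_def)
    ultimately show "\<exists>q\<in>free_alg (cohn_gens G). rep act q \<phi> = point b" by blast
  qed (simp_all add: rep_zero rep_add rep_scale rep_act_gen_ideal)
  moreover have "inj_on ?pt (walks G)"
  proof (rule inj_onI)
    \<comment> \<open>the integer component records the length\<close>
    have deg: "snd (snd (snd (foldr (generic_pre G X) p b))) = snd (snd (snd b)) + int (length p)" for p b
      by (induction p) (auto simp: generic_pre_def Let_def split: prod.splits)
    have uniq: "u = u' \<and> p = p' \<and> v = v'" if "length p = length p'" "awalk u p v" "awalk u' p' v'"
      "foldr (generic_pre G X) p (base v) = foldr (generic_pre G X) p' (base v')" for u p v u' p' v'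
      using that
    proof (induction p p' arbitrary: u u' rule: list_induct2)
      case Nil
      then show ?case by (auto simp: base_def awalk_Nil_iff)
    next
      case (Cons e p e' p')
      then have w: "e \<in> arcs G" "awalk (head G e) p v" "e' \<in> arcs G" "awalk (head G e') p' v'"
        "u = tail G e" "u' = tail G e'"
        by (auto simp: awalk_Cons_iff)
      have src: "fst (foldr (generic_pre G X) p (base v)) = head G e"
         "fst (foldr (generic_pre G X) p' (base v')) = head G e'"
        using foldr_pre[OF w(2)] foldr_pre[OF w(4)] by (simp_all add: base_def)
      have "e = e' \<and> foldr (generic_pre G X) p (base v) = foldr (generic_pre G X) p' (base v')"
        by (rule pre_inj) (use w src Cons in auto)
      then show ?case using Cons.IH[OF w(2,4)] w by auto
    qed
    fix x y assume xy: "x \<in> walks G" "y \<in> walks G" "?pt x = ?pt y"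
    obtain u p v u' p' v' where eq: "x = (u, p, v)" "y = (u', p', v')" by (cases x, cases y)
    have len: "length p = length p'"
      using xy(3) deg[of p "base v"] deg[of p' "base v'"] by (simp add: eq base_def)
    show "x = y" using uniq[OF len] xy by (auto simp: eq walks_def)
  qed
  ultimately show ?thesis by (rule finite_imageD)
qed

section \<open>Block matrix algebras\<close>

text \<open>
  For a colouring of a finite set \<open>P\<close>, the matrices indexed by \<open>P\<close> whose entries vanish between
  points of different colours: a direct product of full matrix algebras, one for each colour, whose
  size is the number of points of that colour.
\<close>

definition block_matrices :: "'k::field itself \<Rightarrow> 'p set \<Rightarrow> ('p \<Rightarrow> 'c) \<Rightarrow> ('k, 'p \<times> 'p \<Rightarrow> 'k) nu_algebra" where
  "block_matrices _ P col =
    \<lparr>carrier = {f. \<forall>a b. f (a, b) \<noteq> 0 \<longrightarrow> a \<in> P \<and> b \<in> P \<and> col a = col b},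
     alg_zero = (\<lambda>_. 0),
     alg_add = (\<lambda>f g s. f s + g s),
     alg_mult = (\<lambda>f g (a, b). \<Sum>c\<in>P. f (a, c) * g (c, b)),
     alg_smult = (\<lambda>c f s. c * f s)\<rparr>"

definition block :: "'p set \<Rightarrow> ('p \<Rightarrow> 'c) \<Rightarrow> 'c \<Rightarrow> ('p \<times> 'p \<Rightarrow> 'k::field) set" where
  "block P col i = {f. \<forall>a b. f (a, b) \<noteq> 0 \<longrightarrow> a \<in> P \<and> b \<in> P \<and> col a = i \<and> col b = i}"

abbreviation fibre :: "'p set \<Rightarrow> ('p \<Rightarrow> 'c) \<Rightarrow> 'c \<Rightarrow> 'p set" where
  "fibre P col i \<equiv> {a \<in> P. col a = i}"

lemma block_matrices_simps [simp]:
  "f \<in> carrier (block_matrices TYPE('k) P col) \<longleftrightarrow>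
     (\<forall>a b. f (a, b) \<noteq> 0 \<longrightarrow> a \<in> P \<and> b \<in> P \<and> col a = col b)"
  "alg_zero (block_matrices TYPE('k) P col) = (\<lambda>_. 0)"
  "alg_add (block_matrices TYPE('k) P col) f g = (\<lambda>s. f s + g s)"
  "alg_mult (block_matrices TYPE('k) P col) f g (a, b) = (\<Sum>c\<in>P. f (a, c) * g (c, b))"
  "alg_smult (block_matrices TYPE('k) P col) c f = (\<lambda>s. c * f s)"
  for f g :: "'p \<times> 'p \<Rightarrow> 'k::field"
  by (simp_all add: block_matrices_def)

lemma op_closed_block_matrices: "op_closed (block_matrices TYPE('k::field) P col)"
  unfolding op_closed_def
proof (intro conjI ballI allI)
  let ?M = "block_matrices TYPE('k::field) P col"
  fix f g assume fg: "f \<in> carrier ?M" "g \<in> carrier ?M"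
  show "alg_add ?M f g \<in> carrier ?M"
  proof (unfold block_matrices_simps, intro allI impI)
    fix a b assume "f (a, b) + g (a, b) \<noteq> 0"
    then have "f (a, b) \<noteq> 0 \<or> g (a, b) \<noteq> 0" by auto
    then show "a \<in> P \<and> b \<in> P \<and> col a = col b" using fg by auto
  qed
  show "alg_mult ?M f g \<in> carrier ?M"
  proof (unfold block_matrices_simps, intro allI impI)
    fix a b assume "(\<Sum>c\<in>P. f (a, c) * g (c, b)) \<noteq> 0"
    then obtain c where "f (a, c) * g (c, b) \<noteq> 0" by (meson sum.neutral)
    then have "f (a, c) \<noteq> 0" "g (c, b) \<noteq> 0" by auto
    then show "a \<in> P \<and> b \<in> P \<and> col a = col b" using fg by auto
  qed
next
  fix c f assume "f \<in> carrier (block_matrices TYPE('k::field) P col)"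
  then show "alg_smult (block_matrices TYPE('k::field) P col) c f
      \<in> carrier (block_matrices TYPE('k::field) P col)" by auto
qed

lemma point_in_block_matrices:
  "a \<in> P \<Longrightarrow> b \<in> P \<Longrightarrow> col a = col b \<Longrightarrow> point (a, b) \<in> carrier (block_matrices TYPE('k::field) P col)"
  by (auto simp: point_def)

lemma mult_point_left:
  assumes "finite P" "p \<in> P"
  shows "alg_mult (block_matrices TYPE('k::field) P col) (point (r, p)) y
    = (\<lambda>(a, b). if a = r then y (p, b) else 0)"
proof (rule ext, clarify)
  fix a b
  have "(\<Sum>c\<in>P. point (r, p) (a, c) * y (c, b)) = (\<Sum>c\<in>P. if c = p then (if a = r then y (p, b) else 0) else 0)"
    by (rule sum.cong) (auto simp: point_def)
  then show "alg_mult (block_matrices TYPE('k) P col) (point (r, p)) y (a, b)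
     = (if a = r then y (p, b) else 0)"
    using assms by simp
qed

lemma mult_point_right:
  assumes "finite P" "q \<in> P"
  shows "alg_mult (block_matrices TYPE('k::field) P col) y (point (q, s))
    = (\<lambda>(a, b). if b = s then y (a, q) else 0)"
proof (rule ext, clarify)
  fix a b
  have "(\<Sum>c\<in>P. y (a, c) * point (q, s) (c, b)) = (\<Sum>c\<in>P. if c = q then (if b = s then y (a, q) else 0) else 0)"
    by (rule sum.cong) (auto simp: point_def)
  then show "alg_mult (block_matrices TYPE('k) P col) y (point (q, s)) (a, b)
     = (if b = s then y (a, q) else 0)"
    using assms by simp
qed

lemma iso_zero:
  assumes "alg_iso (block_matrices TYPE('k::field) P col) (block_matrices TYPE('k) P' col') h"
  shows "h (\<lambda>_. 0) = (\<lambda>_. 0)"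
proof -
  have "h (alg_smult (block_matrices TYPE('k) P col) 0 (\<lambda>_. 0))
      = alg_smult (block_matrices TYPE('k) P' col') 0 (h (\<lambda>_. 0))"
    using assms unfolding alg_iso_def by (metis (no_types, lifting) block_matrices_simps(1))
  then show ?thesis by simp
qed

lemma iso_sum_points:
  assumes iso: "alg_iso (block_matrices TYPE('k::field) P col) (block_matrices TYPE('k) P' col') h"
    and "finite S" "\<And>a b. (a, b) \<in> S \<Longrightarrow> a \<in> P \<and> b \<in> P \<and> col a = col b"
  shows "h (\<lambda>x. \<Sum>s\<in>S. c s * point s x) = (\<lambda>x. \<Sum>s\<in>S. c s * h (point s) x)"
  using assms(2,3)
proof (induction S)
  case empty
  then show ?case using iso_zero[OF iso] by simp
next
  case (insert s S)
  let ?M = "block_matrices TYPE('k::field) P col" and ?M' = "block_matrices TYPE('k) P' col'"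
  let ?f = "\<lambda>x. \<Sum>s\<in>S. c s * point s x"
  have pt: "point t \<in> carrier ?M" if "t \<in> insert s S" for t
    using that insert.prems by (cases t) (metis point_in_block_matrices)
  have f: "?f \<in> carrier ?M"
  proof (unfold block_matrices_simps, intro allI impI)
    fix a b assume "(\<Sum>s\<in>S. c s * point s (a, b)) \<noteq> 0"
    then obtain t where t: "t \<in> S" "c t * point t (a, b) \<noteq> 0" by (meson sum.neutral)
    then have "t = (a, b)" by (auto simp: point_def split: if_splits)
    with t insert.prems show "a \<in> P \<and> b \<in> P \<and> col a = col b" by blast
  qed
  have sm: "alg_smult ?M (c s) (point s) \<in> carrier ?M"
    using pt[of s] op_closed_block_matrices[of P col, where 'k='k] by (simp only: op_closed_def insertI1)
  have IH: "h ?f = (\<lambda>x. \<Sum>s\<in>S. c s * h (point s) x)"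
    by (rule insert.IH) (use insert.prems in blast)
  have "h (\<lambda>x. \<Sum>s\<in>insert s S. c s * point s x) = h (alg_add ?M (alg_smult ?M (c s) (point s)) ?f)"
    using insert.hyps by simp
  also have "\<dots> = alg_add ?M' (alg_smult ?M' (c s) (h (point s))) (h ?f)"
    using iso f pt[of s] sm unfolding alg_iso_def by (simp del: block_matrices_simps)
  also have "\<dots> = (\<lambda>x. \<Sum>s\<in>insert s S. c s * h (point s) x)"
    using insert.hyps by (simp add: IH)
  finally show ?case .
qed

lemma block_eq_sum_points:
  assumes "finite P" "f \<in> block P col i"
  shows "f = (\<lambda>x. \<Sum>s\<in>fibre P col i \<times> fibre P col i. f s * point s x)"
  by (rule fun_eq_sum_points) (use assms in \<open>auto simp: block_def\<close>)

lemma block_sum: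
  assumes "\<And>s. s \<in> S \<Longrightarrow> f s \<in> block P col i"
  shows "(\<lambda>x. \<Sum>s\<in>S. c s * f s x) \<in> block P col i"
  unfolding block_def
proof (intro CollectI allI impI)
  fix a b assume "(\<Sum>s\<in>S. c s * f s (a, b)) \<noteq> 0"
  then obtain s where "s \<in> S" "c s * f s (a, b) \<noteq> 0" by (meson sum.neutral)
  then have "s \<in> S" "f s (a, b) \<noteq> 0" by auto
  then show "a \<in> P \<and> b \<in> P \<and> col a = i \<and> col b = i"
    using assms[of s] unfolding block_def by blast
qed

text \<open>
  A block is spanned by its matrix units, so an isomorphism can be located on these alone.
\<close>

lemma iso_block:
  assumes iso: "alg_iso (block_matrices TYPE('k::field) P col) (block_matrices TYPE('k) P' col') h"
    and fin: "finite P"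
    and pts: "\<And>r s. r \<in> fibre P col i \<Longrightarrow> s \<in> fibre P col i \<Longrightarrow> h (point (r, s)) \<in> block P' col' j"
    and f: "f \<in> block P col i"
  shows "h f \<in> block P' col' j"
proof -
  let ?F = "fibre P col i"
  have "h f = h (\<lambda>x. \<Sum>s\<in>?F \<times> ?F. f s * point s x)"
    using block_eq_sum_points[OF fin f] by simp
  also have "\<dots> = (\<lambda>x. \<Sum>s\<in>?F \<times> ?F. f s * h (point s) x)"
    by (rule iso_sum_points[OF iso]) (use fin in auto)
  also have "\<dots> \<in> block P' col' j"
    by (rule block_sum) (use pts in auto)
  finally show ?thesis .
qed

text \<open>
  For a linear map \<open>g\<close> this says that the whole block \<open>j\<close> goes into the block \<open>i\<close>.
\<close>

definition maps_block_into :: "'q set \<Rightarrow> ('q \<Rightarrow> 'd) \<Rightarrow> 'd \<Rightarrow> 'p set \<Rightarrow> ('p \<Rightarrow> 'c) \<Rightarrow> 'c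
    \<Rightarrow> (('q \<times> 'q \<Rightarrow> 'k::field) \<Rightarrow> 'p \<times> 'p \<Rightarrow> 'k) \<Rightarrow> bool" where
  "maps_block_into P' col' j P col i g \<longleftrightarrow>
    (\<forall>r \<in> fibre P' col' j. \<forall>s \<in> fibre P' col' j. g (point (r, s)) \<in> block P col i)"

text \<open>
  Blocks are minimal ideals. The image \<open>y\<close> of a diagonal matrix unit \<open>e\<close> is nonzero, so it has a
  nonzero entry at some \<open>(p, q)\<close>. Multiplying \<open>y\<close> by matrix units on both sides produces,
  up to a nonzero scalar, every matrix unit of the block of \<open>p\<close>. Pulled back, each of them is a
  multiple of \<open>U e V\<close> for suitable \<open>U\<close> and \<open>V\<close>, and such products lie in the block of \<open>e\<close>.
\<close>

lemma exists_block_into: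
  assumes iso: "alg_iso (block_matrices TYPE('k::field) P col) (block_matrices TYPE('k) P' col') h"
    and fin: "finite P" "finite P'" and a: "a \<in> P"
  defines "g \<equiv> inv_into (carrier (block_matrices TYPE('k) P col)) h"
  shows "\<exists>p\<in>P'. maps_block_into P' col' (col' p) P col (col a) g"
proof -
  let ?M = "block_matrices TYPE('k::field) P col" and ?M' = "block_matrices TYPE('k) P' col'"
  have bij: "bij_betw h (carrier ?M) (carrier ?M')" using iso by (simp add: alg_iso_def)
  have mem: "h x \<in> carrier ?M'" if "x \<in> carrier ?M" for x using bij_betwE[OF bij] that by blast
  have g: "g y \<in> carrier ?M" "h (g y) = y" if "y \<in> carrier ?M'" for y
    using that bij_betwE[OF bij_betw_inv_into[OF bij]] bij_betw_inv_into_right[OF bij] unfolding g_def by auto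
  have gh: "g (h x) = x" if "x \<in> carrier ?M" for x
    unfolding g_def using bij_betw_inv_into_left[OF bij that] .
  have hmult: "h (alg_mult ?M x y) = alg_mult ?M' (h x) (h y)" if "x \<in> carrier ?M" "y \<in> carrier ?M" for x y
    using iso that unfolding alg_iso_def by blast
  have hsmult: "h (alg_smult ?M c x) = alg_smult ?M' c (h x)" if "x \<in> carrier ?M" for c x
    using iso that unfolding alg_iso_def by blast
  have cl: "alg_mult ?M x y \<in> carrier ?M" "alg_smult ?M c x \<in> carrier ?M"
    if "x \<in> carrier ?M" "y \<in> carrier ?M" for x y c
    using op_closed_block_matrices[of P col, where 'k='k] that unfolding op_closed_def by blast+
  let ?e = "point (a, a) :: 'a \<times> 'a \<Rightarrow> 'k"
  define y where "y = h ?e"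
  have e: "?e \<in> carrier ?M" using a by (intro point_in_block_matrices) auto
  have "y \<noteq> (\<lambda>_. 0)"
  proof
    assume "y = (\<lambda>_. 0)"
    then have "h ?e = h (\<lambda>_. 0)" using iso_zero[OF iso] by (simp add: y_def)
    moreover have "(\<lambda>_. 0) \<in> carrier ?M" by simp
    ultimately have "?e = (\<lambda>_. 0)" using gh[OF e] gh by metis
    then have "?e (a, a) = 0" by simp
    then show False by (simp add: point_def)
  qed
  then obtain p q where pq: "y (p, q) \<noteq> 0" by (auto simp: fun_eq_iff)
  have yM: "y \<in> carrier ?M'" using mem[OF e] by (simp add: y_def)
  then have pq': "p \<in> P'" "q \<in> P'" "col' p = col' q" using pq by auto
  show ?thesis unfolding maps_block_into_def
  proof (intro bexI ballI)
    fix r s assume rs: "r \<in> fibre P' col' (col' p)" "s \<in> fibre P' col' (col' p)"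
    let ?c = "1 / y (p, q)"
    define U V where "U = g (point (r, p))" and "V = g (point (q, s))"
    have "point (r, p) \<in> carrier ?M'" "point (q, s) \<in> carrier ?M'"
      using pq' rs by (auto intro!: point_in_block_matrices simp del: block_matrices_simps)
    then have UV: "U \<in> carrier ?M" "V \<in> carrier ?M" "h U = point (r, p)" "h V = point (q, s)"
      using g unfolding U_def V_def by blast+
    define w where "w = alg_smult ?M ?c (alg_mult ?M U (alg_mult ?M ?e V))"
    have "alg_mult ?M ?e V = (\<lambda>(x, z). if x = a then V (a, z) else 0)"
      by (rule mult_point_left) fact+
    then have w_eq: "w (x, z) = ?c * (U (x, a) * V (a, z))" for x z
      unfolding w_def using fin a by (simp add: if_distrib cong: if_cong)
    have w: "w \<in> block P col (col a)"
      unfolding block_def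
    proof (intro CollectI allI impI)
      fix x z assume "w (x, z) \<noteq> 0"
      then have "U (x, a) \<noteq> 0" "V (a, z) \<noteq> 0" unfolding w_eq by auto
      then show "x \<in> P \<and> z \<in> P \<and> col x = col a \<and> col z = col a"
        using UV(1,2) by fastforce
    qed
    have eV: "alg_mult ?M ?e V \<in> carrier ?M" by (rule cl(1)[OF e UV(2)])
    have wM: "w \<in> carrier ?M" unfolding w_def by (rule cl(2)[OF cl(1)[OF UV(1) eV] e])
    have "h w = alg_smult ?M' ?c (alg_mult ?M' (h U) (alg_mult ?M' (h ?e) (h V)))"
      unfolding w_def hsmult[OF cl(1)[OF UV(1) eV]] hmult[OF UV(1) eV] hmult[OF e UV(2)] ..
    then have "h w = alg_smult ?M' ?c (alg_mult ?M' (point (r, p)) (alg_mult ?M' y (point (q, s))))"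
      by (simp only: UV(3,4) y_def)
    also have "\<dots> = point (r, s)"
      unfolding mult_point_left[OF fin(2) pq'(1)] mult_point_right[OF fin(2) pq'(2)]
      using pq by (auto simp: point_def fun_eq_iff)
    finally have "g (point (r, s)) = w" using gh[OF wM] by simp
    then show "g (point (r, s)) \<in> block P col (col a)" using w by simp
  qed fact
qed

text \<open>
  If \<open>n\<close> and \<open>n'\<close> are the sizes of the two fibres, the matrix units of the first block are linear
  combinations of the images of the \<open>n'\<^sup>2\<close> matrix units of the second, so \<open>n\<^sup>2 \<le> n'\<^sup>2\<close>.
\<close>

lemma card_fibre_le:
  assumes iso: "alg_iso (block_matrices TYPE('k::field) P col) (block_matrices TYPE('k) P' col') h"
    and fin: "finite P" "finite P'"
  defines "g \<equiv> inv_into (carrier (block_matrices TYPE('k) P col)) h"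
  assumes isog: "alg_iso (block_matrices TYPE('k::field) P' col') (block_matrices TYPE('k) P col) g"
    and cov: "maps_block_into P col i P' col' j h"
  shows "card (fibre P col i) \<le> card (fibre P' col' j)"
proof -
  let ?M = "block_matrices TYPE('k::field) P col"
  let ?F = "fibre P col i" and ?F' = "fibre P' col' j"
  let ?T = "(\<lambda>t. g (point t)) ` (?F' \<times> ?F')"
  have bij: "bij_betw h (carrier ?M) (carrier (block_matrices TYPE('k) P' col'))"
    using iso by (simp add: alg_iso_def)
  have "finite (?F \<times> ?F) \<and> card (?F \<times> ?F) \<le> card ?T"
  proof (rule card_le_if_points_in_span)
    fix s assume s: "s \<in> ?F \<times> ?F"
    then have "point s \<in> carrier ?M"
      by (cases s) (auto intro!: point_in_block_matrices simp del: block_matrices_simps)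
    then have "point s = g (h (point s))" unfolding g_def using bij_betw_inv_into_left[OF bij] by metis
    also have "h (point s) = (\<lambda>x. \<Sum>t\<in>?F' \<times> ?F'. h (point s) t * point t x)"
      by (rule block_eq_sum_points[OF fin(2)]) (use cov s in \<open>auto simp: maps_block_into_def\<close>)
    also have "g \<dots> = (\<lambda>x. \<Sum>t\<in>?F' \<times> ?F'. h (point s) t * g (point t) x)"
      by (rule iso_sum_points[OF isog]) (use fin in auto)
    also have "\<dots> = (\<Sum>t\<in>?F' \<times> ?F'. (\<lambda>x. h (point s) t * g (point t) x))"
      by (simp add: fun_eq_iff sum_fun_apply)
    also have "\<dots> \<in> fun_space.span ?T"
      by (intro fun_space.span_sum fun_space.span_scale fun_space.span_base) auto
    finally show "(point s :: 'a \<times> 'a \<Rightarrow> 'k) \<in> fun_space.span ?T" .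
  qed (use fin in auto)
  moreover have "card ?T \<le> card (?F' \<times> ?F')" using fin by (intro card_image_le) auto
  ultimately have "card ?F * card ?F \<le> card ?F' * card ?F'"
    by (simp add: card_cartesian_product)
  then show ?thesis by (simp add: power2_nat_le_eq_le flip: power2_eq_square)
qed

text \<open>
  Purely combinatorial: a matching of the colours that preserves the sizes of the fibres can be
  realised by a bijection of the points.
\<close>

lemma bijection_from_fibres:
  assumes fin: "finite P" "finite P'"
    and left: "\<And>a. a \<in> P \<Longrightarrow> \<exists>p\<in>P'. R (col a) (col' p)"
    and right: "\<And>p. p \<in> P' \<Longrightarrow> \<exists>a\<in>P. R (col a) (col' p)"
    and uniq: "\<And>i i' j j'. R i j \<Longrightarrow> R i' j' \<Longrightarrow> i = i' \<longleftrightarrow> j = j'"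
    and card: "\<And>i j. R i j \<Longrightarrow> card (fibre P col i) = card (fibre P' col' j)"
  shows "\<exists>\<sigma>. bij_betw \<sigma> P P' \<and> (\<forall>a\<in>P. \<forall>b\<in>P. col a = col b \<longleftrightarrow> col' (\<sigma> a) = col' (\<sigma> b))"
proof -
  obtain m where m: "\<And>a. a \<in> P \<Longrightarrow> R (col a) (m (col a))"
  proof -
    have "\<forall>i\<in>col ` P. \<exists>j. R i j" using left by blast
    then obtain m where "\<forall>i\<in>col ` P. R i (m i)" using bchoice by metis
    then show ?thesis using that by blast
  qed
  have "\<exists>s. bij_betw s (fibre P col (col a)) (fibre P' col' (m (col a)))" if "a \<in> P" for a
    using card[OF m[OF that]] fin by (intro finite_same_card_bij) auto
  then have "\<forall>i\<in>col ` P. \<exists>s. bij_betw s (fibre P col i) (fibre P' col' (m i))" by blast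
  then obtain S where "\<forall>i\<in>col ` P. bij_betw (S i) (fibre P col i) (fibre P' col' (m i))"
    by metis
  then have S: "bij_betw (S (col a)) (fibre P col (col a)) (fibre P' col' (m (col a)))" if "a \<in> P" for a
    using that by blast
  define \<sigma> where "\<sigma> a = S (col a) a" for a
  have \<sigma>: "\<sigma> a \<in> P'" "col' (\<sigma> a) = m (col a)" if "a \<in> P" for a
    using bij_betwE[OF S[OF that]] that by (auto simp: \<sigma>_def)
  have col: "col a = col b \<longleftrightarrow> col' (\<sigma> a) = col' (\<sigma> b)" if "a \<in> P" "b \<in> P" for a b
    using uniq[OF m m, OF that] \<sigma> that by simp
  have "inj_on \<sigma> P"
  proof (rule inj_onI)
    fix a b assume ab: "a \<in> P" "b \<in> P" "\<sigma> a = \<sigma> b"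
    then have "col a = col b" using col by simp
    then show "a = b"
      using inj_onD[OF bij_betw_imp_inj_on[OF S[OF ab(1)]], of a b] ab by (simp add: \<sigma>_def)
  qed
  moreover have "p \<in> \<sigma> ` P" if p: "p \<in> P'" for p
  proof -
    obtain a where a: "a \<in> P" "R (col a) (col' p)" using right[OF p] by blast
    then have "p \<in> fibre P' col' (m (col a))" using uniq[OF m[OF a(1)] a(2)] p by simp
    then have "p \<in> S (col a) ` fibre P col (col a)"
      using bij_betw_imp_surj_on[OF S[OF a(1)]] by (simp only:)
    then obtain b where "b \<in> fibre P col (col a)" "S (col a) b = p" by blast
    then have "p = \<sigma> b" "b \<in> P" by (simp_all add: \<sigma>_def)
    then show ?thesis by (rule image_eqI)
  qed
  ultimately have "bij_betw \<sigma> P P'" using \<sigma>(1) by (auto simp: bij_betw_def)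
  with col show ?thesis by blast
qed

text \<open>
  Uniqueness in the Wedderburn decomposition. Applying \<open>exists_block_into\<close> to the isomorphism and
  to its inverse gives for each block one on the other side that is carried into it, and vice versa;
  starting at a block, going across and back must return to that block, as distinct blocks share no
  diagonal matrix unit. So the isomorphism matches the blocks, and it preserves their dimensions.
\<close>

lemma bijection_if_block_matrices_iso:
  fixes P :: "'p set" and P' :: "'q set"
  assumes "block_matrices TYPE('k::field) P col \<cong>\<^sub>a block_matrices TYPE('k) P' col'"
    and fin: "finite P" "finite P'"
  shows "\<exists>\<sigma>. bij_betw \<sigma> P P' \<and> (\<forall>a\<in>P. \<forall>b\<in>P. col a = col b \<longleftrightarrow> col' (\<sigma> a) = col' (\<sigma> b))"
proof -
  let ?M = "block_matrices TYPE('k::field) P col" and ?M' = "block_matrices TYPE('k) P' col'"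
  obtain h where iso: "alg_iso ?M ?M' h" using assms(1) by (auto simp: alg_isomorphic_def)
  define g where "g = inv_into (carrier ?M) h"
  have isog: "alg_iso ?M' ?M g"
    unfolding g_def by (rule alg_iso_inv[OF op_closed_block_matrices iso])
  have bij: "bij_betw h (carrier ?M) (carrier ?M')" using iso by (simp add: alg_iso_def)
  have gh: "g (h x) = x" if "x \<in> carrier ?M" for x
    unfolding g_def using bij_betw_inv_into_left[OF bij that] .
  have hg: "h (g x) = x" if "x \<in> carrier ?M'" for x
    unfolding g_def using bij_betw_inv_into_right[OF bij that] .
  \<comment> \<open>the inverse of \<open>g\<close> as a function may differ from \<open>h\<close> outside the carrier\<close>
  define h' where "h' = inv_into (carrier ?M') g"
  have hh': "h' x = h x" if "x \<in> carrier ?M" for x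
  proof -
    have "h x \<in> carrier ?M'" "g (h x) = x" using that gh bij_betwE[OF bij] by auto
    then show ?thesis unfolding h'_def using isog
      by (metis alg_iso_def bij_betw_inv_into_left)
  qed
  have covh: "maps_block_into P col i P' col' j h' \<longleftrightarrow> maps_block_into P col i P' col' j h" for i j
    unfolding maps_block_into_def using hh' by (simp add: point_in_block_matrices del: block_matrices_simps)
  \<comment> \<open>the pairs of blocks that \<open>h\<close> and its inverse carry into one another\<close>
  define R where "R i j \<longleftrightarrow> (\<exists>a\<in>P. col a = i) \<and> (\<exists>p\<in>P'. col' p = j) \<and>
    maps_block_into P' col' j P col i g \<and> maps_block_into P col i P' col' j h" for i j
  have bc: "\<exists>p\<in>P'. maps_block_into P' col' (col' p) P col (col a) g" if "a \<in> P" for a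
    using exists_block_into[OF iso fin that] unfolding g_def .
  have bc': "\<exists>a\<in>P. maps_block_into P col (col a) P' col' (col' p) h" if "p \<in> P'" for p
    using exists_block_into[OF isog fin(2,1) that] unfolding h'_def[symmetric] covh .
  have gblock: "g f \<in> block P col i"
    if "f \<in> block P' col' j" "maps_block_into P' col' j P col i g" for f i j
    using iso_block[OF isog fin(2)] that unfolding maps_block_into_def by blast
  have hblock: "h f \<in> block P' col' j"
    if "f \<in> block P col i" "maps_block_into P col i P' col' j h" for f i j
    using iso_block[OF iso fin(1)] that unfolding maps_block_into_def by blast
  have pt: "point (a, a) \<in> carrier ?M" if "a \<in> P" for a
    using that by (intro point_in_block_matrices) auto
  have pt': "point (a, a) \<in> carrier ?M'" if "a \<in> P'" for a
    using that by (intro point_in_block_matrices) auto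
  have col_eq: "col a = i" if "(point (a, a) :: 'p \<times> 'p \<Rightarrow> 'k) \<in> block P col i" for a i
    using that by (auto simp: block_def point_def)
  have col_eq': "col' a = i" if "(point (a, a) :: 'q \<times> 'q \<Rightarrow> 'k) \<in> block P' col' i" for a i
    using that by (auto simp: block_def point_def)
  \<comment> \<open>the diagonal unit at \<open>a\<close> goes to block \<open>j\<close> and returns into block \<open>i\<close>, so \<open>a\<close> has colour \<open>i\<close>\<close>
  have glink: "col a = i"
    if "a \<in> P" "maps_block_into P col (col a) P' col' j h" "maps_block_into P' col' j P col i g" for a i j
  proof (rule col_eq)
    have "h (point (a, a)) \<in> block P' col' j" using that by (simp add: maps_block_into_def)
    then have "g (h (point (a, a))) \<in> block P col i" using gblock that(3) by blast
    then show "(point (a, a) :: 'p \<times> 'p \<Rightarrow> 'k) \<in> block P col i" using gh[OF pt[OF that(1)]] by simp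
  qed
  have hlink: "col' p = j"
    if "p \<in> P'" "maps_block_into P' col' (col' p) P col i g" "maps_block_into P col i P' col' j h" for p i j
  proof (rule col_eq')
    have "g (point (p, p)) \<in> block P col i" using that by (simp add: maps_block_into_def)
    then have "h (g (point (p, p))) \<in> block P' col' j" using hblock that(3) by blast
    then show "(point (p, p) :: 'q \<times> 'q \<Rightarrow> 'k) \<in> block P' col' j" using hg[OF pt'[OF that(1)]] by simp
  qed
  show ?thesis
  proof (rule bijection_from_fibres[OF fin, of R])
    fix a assume a: "a \<in> P"
    obtain p where p: "p \<in> P'" "maps_block_into P' col' (col' p) P col (col a) g" using bc[OF a] by blast
    obtain a' where a': "a' \<in> P" "maps_block_into P col (col a') P' col' (col' p) h" using bc'[OF p(1)] by blast
    have "col a' = col a" using glink[OF a' p(2)] .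
    then have "R (col a) (col' p)" using a p a' unfolding R_def by auto
    then show "\<exists>p\<in>P'. R (col a) (col' p)" using p by blast
  next
    fix p assume p: "p \<in> P'"
    obtain a where a: "a \<in> P" "maps_block_into P col (col a) P' col' (col' p) h" using bc'[OF p(1)] by blast
    obtain p' where p': "p' \<in> P'" "maps_block_into P' col' (col' p') P col (col a) g" using bc[OF a(1)] by blast
    have "col' p' = col' p" using hlink[OF p' a(2)] .
    then have "R (col a) (col' p)" using a p p' unfolding R_def by auto
    then show "\<exists>a\<in>P. R (col a) (col' p)" using a by blast
  next
    fix i i' j j' assume "R i j" "R i' j'"
    then show "i = i' \<longleftrightarrow> j = j'" unfolding R_def using glink hlink by metis
  next
    fix i j assume R: "R i j"
    have "card (fibre P col i) \<le> card (fibre P' col' j)"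
      by (rule card_fibre_le[OF iso fin, folded g_def, OF isog]) (use R in \<open>simp add: R_def\<close>)
    moreover have "card (fibre P' col' j) \<le> card (fibre P col i)"
    proof (rule card_fibre_le[OF isog fin(2,1), folded h'_def])
      show "alg_iso ?M ?M' h'"
        unfolding h'_def by (rule alg_iso_inv[OF op_closed_block_matrices isog])
    qed (use R in \<open>simp add: R_def\<close>)
    ultimately show "card (fibre P col i) = card (fibre P' col' j)" by simp
  qed
qed

text \<open>
  Relabel the rows and columns along the bijection.
\<close>

lemma block_matrices_iso_if_bijection:
  fixes \<sigma> :: "'p \<Rightarrow> 'q"
  assumes bij: "bij_betw \<sigma> P P'"
    and col: "\<And>a b. a \<in> P \<Longrightarrow> b \<in> P \<Longrightarrow> col a = col b \<longleftrightarrow> col' (\<sigma> a) = col' (\<sigma> b)"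
  shows "block_matrices TYPE('k::field) P col \<cong>\<^sub>a block_matrices TYPE('k) P' col'"
proof -
  let ?M = "block_matrices TYPE('k::field) P col" and ?M' = "block_matrices TYPE('k) P' col'"
  define h :: "('p \<times> 'p \<Rightarrow> 'k) \<Rightarrow> 'q \<times> 'q \<Rightarrow> 'k" where
    "h f = (\<lambda>(x, y). if x \<in> P' \<and> y \<in> P' then f (inv_into P \<sigma> x, inv_into P \<sigma> y) else 0)" for f
  let ?g = "\<lambda>f (a, b). if a \<in> P \<and> b \<in> P then f (\<sigma> a, \<sigma> b) else (0::'k)"
  have \<sigma>: "\<sigma> a \<in> P'" "inv_into P \<sigma> (\<sigma> a) = a" if "a \<in> P" for a
    using that bij_betwE[OF bij] bij_betw_inv_into_left[OF bij] by auto
  have \<tau>: "inv_into P \<sigma> x \<in> P" "\<sigma> (inv_into P \<sigma> x) = x" if "x \<in> P'" for x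
    using that bij_betwE[OF bij_betw_inv_into[OF bij]] bij_betw_inv_into_right[OF bij] by auto
  have "bij_betw h (carrier ?M) (carrier ?M')"
  proof (rule bij_betw_byWitness[of _ ?g])
    show "\<forall>f\<in>carrier ?M. ?g (h f) = f"
      using \<sigma> by (fastforce simp: h_def fun_eq_iff)
    show "\<forall>f\<in>carrier ?M'. h (?g f) = f"
      using \<tau> by (fastforce simp: h_def fun_eq_iff)
    show "h ` carrier ?M \<subseteq> carrier ?M'"
    proof (clarsimp simp: h_def split: if_splits)
      fix f x y assume "\<forall>a b. f (a, b) \<noteq> 0 \<longrightarrow> a \<in> P \<and> b \<in> P \<and> col a = col b" "x \<in> P'" "y \<in> P'"
        "f (inv_into P \<sigma> x, inv_into P \<sigma> y) \<noteq> (0::'k)"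
      then show "col' x = col' y" using col[of "inv_into P \<sigma> x" "inv_into P \<sigma> y"] \<tau> by auto
    qed
    show "?g ` carrier ?M' \<subseteq> carrier ?M"
      using col by (auto split: if_splits)
  qed
  moreover have "h (alg_mult ?M f f') = alg_mult ?M' (h f) (h f')" for f f'
  proof (rule ext, clarify)
    fix x y
    have "(\<Sum>z\<in>P'. h f (x, z) * h f' (z, y)) = (\<Sum>c\<in>P. h f (x, \<sigma> c) * h f' (\<sigma> c, y))"
      by (rule sum.reindex_bij_betw[OF bij, symmetric])
    also have "\<dots> = (if x \<in> P' \<and> y \<in> P' then \<Sum>c\<in>P. f (inv_into P \<sigma> x, c) * f' (c, inv_into P \<sigma> y) else 0)"
      by (auto simp: h_def \<sigma> intro!: sum.cong)
    finally show "h (alg_mult ?M f f') (x, y) = alg_mult ?M' (h f) (h f') (x, y)"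
      by (simp add: h_def)
  qed
  ultimately have "alg_iso ?M ?M' h"
    unfolding alg_iso_def by (auto simp: h_def fun_eq_iff simp del: block_matrices_simps(1,4))
  then show ?thesis unfolding alg_isomorphic_def by blast
qed

lemma block_matrices_finite_dim:
  assumes fin: "finite P"
  shows "alg_finite_dim (block_matrices TYPE('k::field) P col)"
proof -
  let ?M = "block_matrices TYPE('k::field) P col"
  let ?B = "point ` {(a, b). a \<in> P \<and> b \<in> P \<and> col a = col b} :: ('a \<times> 'a \<Rightarrow> 'k) set"
  have sub: "?B \<subseteq> carrier ?M" by (auto simp: point_def)
  have "finite {(a, b). a \<in> P \<and> b \<in> P \<and> col a = col b}"
    by (rule finite_subset[of _ "P \<times> P"]) (use fin in auto)
  then have "finite ?B" by simp
  moreover have "alg_span ?M ?B = carrier ?M"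
  proof (intro equalityI subsetI)
    fix f assume "f \<in> alg_span ?M ?B"
    then show "f \<in> carrier ?M"
    proof induction
      case (step x b c)
      then show ?case using sub op_closed_block_matrices[of P col, where 'k='k] unfolding op_closed_def by blast
    qed simp
  next
    fix f assume f: "f \<in> carrier ?M"
    have "(\<lambda>x. \<Sum>s\<in>S. f s * point s x) \<in> alg_span ?M ?B"
      if "finite S" "S \<subseteq> {(a, b). a \<in> P \<and> b \<in> P \<and> col a = col b}" for S
      using that
    proof (induction S)
      case empty
      then show ?case using alg_span.zero[of ?M ?B] by simp
    next
      case (insert s S)
      have "alg_add ?M (\<lambda>x. \<Sum>s\<in>S. f s * point s x) (alg_smult ?M (f s) (point s)) \<in> alg_span ?M ?B"
        by (rule alg_span.step) (use insert in auto)
      then show ?case using insert.hyps by (simp add: add.commute)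
    qed
    moreover have "f = (\<lambda>x. \<Sum>s\<in>{(a, b). a \<in> P \<and> b \<in> P \<and> col a = col b}. f s * point s x)"
      by (rule fun_eq_sum_points) (use f \<open>finite {(a, b). a \<in> P \<and> b \<in> P \<and> col a = col b}\<close> in auto)
    ultimately show "f \<in> alg_span ?M ?B"
      using \<open>finite {(a, b). a \<in> P \<and> b \<in> P \<and> col a = col b}\<close> by fastforce
  qed
  ultimately show ?thesis unfolding alg_finite_dim_def using sub by blast
qed

section \<open>Cohn path algebras of graphs with finitely many walks\<close>

definition walk_pre :: "('v, 'e) pre_digraph \<Rightarrow> 'e \<Rightarrow> ('v, 'e) walk \<Rightarrow> ('v, 'e) walk" where
  "walk_pre G e = (\<lambda>(u, p, v). (tail G e, e # p, v))"

definition walks_avoiding :: "('v, 'e) pre_digraph \<Rightarrow> 'v set \<Rightarrow> ('v, 'e) walk set" where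
  "walks_avoiding G X = {(u, p, v) \<in> walks G. v \<notin> X}"

abbreviation target :: "('v, 'e) walk \<Rightarrow> 'v" where
  "target a \<equiv> snd (snd a)"

text \<open>
  The walks ending outside \<open>X\<close>: one that starts in \<open>X\<close> cannot be empty, hence begins with an arc.
\<close>

lemma walk_branching_system:
  assumes "wf_digraph G" "X \<subseteq> regular_verts G"
  shows "branching_system G X (walks_avoiding G X) fst (walk_pre G)"
proof -
  interpret wf_digraph G by fact
  show ?thesis
  proof (unfold_locales, goal_cases)
    case 1
    show ?case by fact
  next
    case (2 e b)
    then show ?case
      by (auto simp: walks_avoiding_def walks_def walk_pre_def awalk_Cons_iff)
  next
    case (3 e b)
    then show ?case by (auto simp: walk_pre_def split: prod.splits)
  next
    case (4 e f b c)
    then show ?case by (auto simp: walk_pre_def split: prod.splits)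
  next
    case (5 b)
    then obtain u p v where b: "b = (u, p, v)" "awalk u p v" "v \<notin> X" "u \<in> X"
      by (auto simp: walks_avoiding_def walks_def)
    then obtain e p' where p: "p = e # p'" by (cases p) (auto simp: awalk_Nil_iff)
    then have "(head G e, p', v) \<in> walks_avoiding G X" "e \<in> out_arcs G u" "b = walk_pre G e (head G e, p', v)"
      using b by (auto simp: walks_avoiding_def walks_def walk_pre_def awalk_Cons_iff)
    moreover have "fst (head G e, p', v) = head G e" "fst b = u" using b by simp_all
    ultimately show ?case by blast
  qed
qed

type_synonym ('v, 'e, 'k) cohn_poly = "(('v, 'e) cohn_gen, 'k) ncpoly"

locale finite_walk_graph = branching_system G X "walks_avoiding G X" fst "walk_pre G"
  for G :: "('v, 'e) pre_digraph" and X +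
  assumes finite_walks: "finite (walks G)"
begin

abbreviation "W \<equiv> walks_avoiding G X"
abbreviation "S \<equiv> cohn_gens G"
abbreviation cong :: "('v, 'e, 'k::field) cohn_poly \<Rightarrow> ('v, 'e, 'k) cohn_poly \<Rightarrow> bool"
    (infix \<open>\<approx>\<close> 50) where
  "p \<approx> q \<equiv> ideal_cong S (cohn_relators G X) p q"
abbreviation vert :: "'v \<Rightarrow> ('v, 'e, 'k::field) cohn_poly" where "vert v \<equiv> gen (Vert v)"
abbreviation edge :: "'e \<Rightarrow> ('v, 'e, 'k::field) cohn_poly" where "edge e \<equiv> gen (Edge e)"
abbreviation ghost :: "'e \<Rightarrow> ('v, 'e, 'k::field) cohn_poly" where "ghost e \<equiv> gen (Ghost e)"

definition edges :: "'e list \<Rightarrow> ('v, 'e, 'k::field) cohn_poly" where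
  "edges p = Poly_Mapping.single (map Edge p) 1"
definition ghosts :: "'e list \<Rightarrow> ('v, 'e, 'k::field) cohn_poly" where
  "ghosts p = Poly_Mapping.single (map Ghost (rev p)) 1"
text \<open>
  The defect \<open>v - (\<Sum>e. e e\<^sup>*)\<close> vanishes in the algebra for \<open>v \<in> X\<close>; for every other \<open>v\<close> it acts on
  walks as the projection to the empty walk at \<open>v\<close>. Framed by walks \<open>a\<close> and \<open>b\<close> with the common
  target \<open>v\<close>, it gives the element that sends \<open>b\<close> to \<open>a\<close> and annihilates all other walks.
\<close>

definition defect :: "'v \<Rightarrow> ('v, 'e, 'k::field) cohn_poly" where
  "defect v = vert v - (\<Sum>e\<in>out_arcs G v. edge e * ghost e)"
definition matrix_unit :: "('v, 'e) walk \<Rightarrow> ('v, 'e) walk \<Rightarrow> ('v, 'e, 'k::field) cohn_poly" where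
  "matrix_unit a b = edges (fst (snd a)) * defect (target a) * ghosts (fst (snd b))"

lemma finite_W: "finite W"
  by (rule finite_subset[OF _ finite_walks]) (auto simp: walks_avoiding_def)

lemma finite_out_arcs: "finite (out_arcs G v)"
proof -
  have "(\<lambda>e. (tail G e, [e], head G e)) ` out_arcs G v \<subseteq> walks G"
    by (auto simp: walks_def intro: arc_implies_awalk)
  then have "finite ((\<lambda>e. (tail G e, [e], head G e)) ` out_arcs G v)"
    using finite_walks by (rule finite_subset)
  then show ?thesis by (rule finite_imageD) (auto intro: inj_onI)
qed

lemma gens: "v \<in> verts G \<Longrightarrow> Vert v \<in> S" "e \<in> arcs G \<Longrightarrow> Edge e \<in> S" "e \<in> arcs G \<Longrightarrow> Ghost e \<in> S"
  by (auto simp: cohn_gens_def)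

lemma defect_in_free_alg: "v \<in> verts G \<Longrightarrow> defect v \<in> free_alg S"
  unfolding defect_def
  by (intro free_alg_diff free_alg_sum free_alg_mult gen_in_free_alg) (auto intro: gens)

lemma unital_edges: "set p \<subseteq> arcs G \<Longrightarrow> edges p \<in> unital_free_alg S"
  unfolding edges_def by (rule unital_single) (auto simp: subset_iff cohn_gens_def)

lemma unital_ghosts: "set p \<subseteq> arcs G \<Longrightarrow> ghosts p \<in> unital_free_alg S"
  unfolding ghosts_def by (rule unital_single) (auto simp: subset_iff cohn_gens_def)

lemma relator_cong: "p - q \<in> cohn_relators G X \<Longrightarrow> p \<approx> q"
  unfolding ideal_cong_def by (rule gen_ideal.base)

lemma vert_vert: "v \<in> verts G \<Longrightarrow> w \<in> verts G \<Longrightarrow> vert v * vert w \<approx> (if v = w then vert v else 0)"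
  by (rule relator_cong) (rule cohn_relators.V)

lemma vert_edge:
  assumes "w \<in> verts G" "e \<in> arcs G"
  shows "vert w * edge e \<approx> (if w = tail G e then edge e else (0 :: ('v, 'e, 'k::field) cohn_poly))"
proof (cases "w = tail G e")
  case True
  then show ?thesis by (auto intro: relator_cong cohn_relators.E1_source assms)
next
  case False
  have t: "tail G e \<in> verts G" using assms by simp
  have "edge e \<approx> vert (tail G e) * (edge e :: ('v, 'e, 'k) cohn_poly)"
    by (rule ideal_cong_sym, rule relator_cong, rule cohn_relators.E1_source, rule assms)
  then have "vert w * edge e \<approx> vert w * (vert (tail G e) * (edge e :: ('v, 'e, 'k) cohn_poly))"
    by (rule ideal_cong_left) (intro unital_gen gens assms)
  also have "\<dots> = vert w * vert (tail G e) * edge e" by (simp add: mult.assoc)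
  also have "\<dots> \<approx> 0 * edge e"
    using vert_vert[OF assms(1) t] False
    by (intro ideal_cong_right unital_gen gens assms) auto
  finally show ?thesis using False by simp
qed

lemma ghost_vert:
  assumes "w \<in> verts G" "e \<in> arcs G"
  shows "ghost e * vert w \<approx> (if w = tail G e then ghost e else (0 :: ('v, 'e, 'k::field) cohn_poly))"
proof (cases "w = tail G e")
  case True
  then show ?thesis by (auto intro: relator_cong cohn_relators.E2_source assms)
next
  case False
  have t: "tail G e \<in> verts G" using assms by simp
  have "ghost e \<approx> ghost e * (vert (tail G e) :: ('v, 'e, 'k) cohn_poly)"
    by (rule ideal_cong_sym, rule relator_cong, rule cohn_relators.E2_source, rule assms)
  then have "ghost e * vert w \<approx> ghost e * (vert (tail G e) :: ('v, 'e, 'k) cohn_poly) * vert w"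
    by (rule ideal_cong_right) (intro unital_gen gens assms)
  also have "\<dots> = ghost e * (vert (tail G e) * vert w)" by (simp add: mult.assoc)
  also have "\<dots> \<approx> ghost e * 0"
    using vert_vert[OF t assms(1)] False
    by (intro ideal_cong_left unital_gen gens assms) auto
  finally show ?thesis using False by simp
qed

lemma edge_head: "e \<in> arcs G \<Longrightarrow> edge e \<approx> edge e * vert (head G e)"
  by (rule ideal_cong_sym, rule relator_cong, rule cohn_relators.E1_range)

lemma ghost_tail: "e \<in> arcs G \<Longrightarrow> ghost e \<approx> ghost e * vert (tail G e)"
  by (rule ideal_cong_sym, rule relator_cong, rule cohn_relators.E2_source)

lemma ghost_edge: "e \<in> arcs G \<Longrightarrow> f \<in> arcs G \<Longrightarrow> ghost e * edge f \<approx> (if e = f then vert (head G e) else 0)"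
  by (rule relator_cong) (rule cohn_relators.CK1)

lemma head_ghost: "e \<in> arcs G \<Longrightarrow> vert (head G e) * ghost e \<approx> ghost e"
  by (rule relator_cong) (rule cohn_relators.E2_range)

lemma vert_defect:
  assumes "v \<in> verts G" "w \<in> verts G"
  shows "vert w * defect v \<approx> (if w = v then defect v else (0 :: ('v, 'e, 'k::field) cohn_poly))"
proof -
  have "vert w * (edge e * ghost e) \<approx> (if w = v then edge e * ghost e else (0 :: ('v, 'e, 'k) cohn_poly))"
    if "e \<in> out_arcs G v" for e
  proof -
    have e: "e \<in> arcs G" "tail G e = v" using that by auto
    have "(vert w * edge e) * ghost e \<approx> (if w = v then edge e else (0 :: ('v, 'e, 'k) cohn_poly)) * ghost e"
      using vert_edge[OF assms(2) e(1)] e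
      by (intro ideal_cong_right unital_gen gens) auto
    then show ?thesis by (auto simp: mult.assoc)
  qed
  then have "(\<Sum>e\<in>out_arcs G v. vert w * (edge e * ghost e))
      \<approx> (\<Sum>e\<in>out_arcs G v. if w = v then edge e * ghost e else (0 :: ('v, 'e, 'k) cohn_poly))"
    by (rule ideal_cong_sum)
  then have "vert w * vert v - (\<Sum>e\<in>out_arcs G v. vert w * (edge e * ghost e)) \<approx>
     (if w = v then vert w else 0)
      - (\<Sum>e\<in>out_arcs G v. if w = v then edge e * ghost e else (0 :: ('v, 'e, 'k) cohn_poly))"
    by (intro ideal_cong_diff vert_vert assms)
  then show ?thesis
    by (cases "w = v") (auto simp: defect_def right_diff_distrib sum_distrib_left)
qed

text \<open>
  In \<open>e\<^sup>* (\<Sum>f. f f\<^sup>*)\<close> only \<open>f = e\<close> can contribute, which happens if \<open>e\<close> leaves \<open>v\<close>. The result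
  \<open>e\<^sup>*\<close> then cancels against \<open>e\<^sup>* v\<close>; otherwise both are zero.
\<close>

lemma ghost_defect:
  assumes "v \<in> verts G" "e \<in> arcs G"
  shows "ghost e * defect v \<approx> (0 :: ('v, 'e, 'k::field) cohn_poly)"
proof -
  have "ghost e * (edge f * ghost f) \<approx> (if f = e then ghost e else (0 :: ('v, 'e, 'k) cohn_poly))"
    if "f \<in> out_arcs G v" for f
  proof -
    have f: "f \<in> arcs G" "tail G f = v" using that by auto
    have "(ghost e * edge f) * ghost f
        \<approx> (if e = f then vert (head G e) else (0 :: ('v, 'e, 'k) cohn_poly)) * ghost f"
      by (intro ideal_cong_right unital_gen gens ghost_edge assms f)
    also have "\<dots> \<approx> (if f = e then ghost e else 0)"
      using head_ghost[OF f(1)] ideal_cong_refl by auto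
    finally show ?thesis by (simp add: mult.assoc)
  qed
  then have "(\<Sum>f\<in>out_arcs G v. ghost e * (edge f * ghost f))
      \<approx> (\<Sum>f\<in>out_arcs G v. if f = e then ghost e else (0 :: ('v, 'e, 'k) cohn_poly))"
    by (rule ideal_cong_sum)
  then have "ghost e * vert v - (\<Sum>f\<in>out_arcs G v. ghost e * (edge f * ghost f)) \<approx>
     (if v = tail G e then ghost e else 0)
      - (\<Sum>f\<in>out_arcs G v. if f = e then ghost e else (0 :: ('v, 'e, 'k) cohn_poly))"
    by (intro ideal_cong_diff ghost_vert assms)
  also have "\<dots> = 0" using assms finite_out_arcs by auto
  finally show ?thesis
    by (simp add: defect_def right_diff_distrib sum_distrib_left)
qed

lemma walks_avoidingD: "(u, p, v) \<in> W \<Longrightarrow> awalk u p v \<and> set p \<subseteq> arcs G \<and> u \<in> verts G \<and> v \<in> verts G \<and> v \<notin> X"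
proof -
  assume "(u, p, v) \<in> W"
  then have w: "awalk u p v" "v \<notin> X" by (simp_all add: walks_avoiding_def walks_def)
  with awalk_hd_in_verts[OF w(1)] awalk_last_in_verts[OF w(1)] show ?thesis
    unfolding awalk_def by blast
qed

lemma edges_Cons: "edges (e # p) = edge e * edges p"
  by (simp add: edges_def gen_mult_single)

lemma edges_Nil: "edges [] = 1" and ghosts_Nil: "ghosts [] = 1"
  using single_one[where 'a = "('v, 'e) cohn_gen list"] by (simp_all add: edges_def ghosts_def zero_list_def)

lemma edges_snoc: "edges (p @ [e]) = edges p * edge e"
  by (simp add: edges_def gen_def mult_single plus_list_def)

lemma ghosts_snoc: "ghosts (p @ [e]) = ghost e * ghosts p"
  by (simp add: ghosts_def gen_mult_single)

lemma unital_matrix_unit: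
  assumes "(u, p, v) \<in> W" "(u', p', v') \<in> W"
  shows "edges p * defect v * ghosts p' \<in> unital_free_alg S"
    and "defect v * ghosts p' \<in> unital_free_alg S" and "ghosts p' \<in> unital_free_alg S"
proof -
  have sets: "set p \<subseteq> arcs G" "set p' \<subseteq> arcs G" "v \<in> verts G"
    using walks_avoidingD[OF assms(1)] walks_avoidingD[OF assms(2)] by simp_all
  show "ghosts p' \<in> unital_free_alg S" by (rule unital_ghosts) fact
  then show *: "defect v * ghosts p' \<in> unital_free_alg S"
    by (rule unital_mult[OF unital_if_free[OF defect_in_free_alg[OF sets(3)]]])
  show "edges p * defect v * ghosts p' \<in> unital_free_alg S"
    unfolding mult.assoc by (intro unital_mult[OF _ *] unital_edges sets)
qed

lemma vert_matrix_unit: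
  assumes a: "a \<in> W" and b: "b \<in> W" and w: "w \<in> verts G"
  shows "vert w * matrix_unit a b
    \<approx> (if w = fst a then matrix_unit a b else (0 :: ('v, 'e, 'k::field) cohn_poly))"
proof -
  obtain u p v u' p' v' where ab: "a = (u, p, v)" "b = (u', p', v')" by (cases a, cases b)
  note un = unital_matrix_unit[of u p v u' p' v'] walks_avoidingD[of u p v]
  show ?thesis
  proof (cases p)
    case Nil
    then have "u = v" "v \<in> verts G" using un a b by (auto simp: ab awalk_Nil_iff)
    then have "vert w * defect v * ghosts p'
        \<approx> (if w = u then defect v else (0 :: ('v, 'e, 'k) cohn_poly)) * ghosts p'"
      using vert_defect[OF _ w, of v] un a b ab by (intro ideal_cong_right) auto
    then show ?thesis by (auto simp: ab matrix_unit_def Nil edges_Nil mult.assoc)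
  next
    case (Cons e q)
    have q: "(head G e, q, v) \<in> W" "e \<in> arcs G" "u = tail G e"
      using a un by (auto simp: ab Cons walks_avoiding_def walks_def awalk_Cons_iff)
    have "(vert w * edge e) * (edges q * defect v * ghosts p')
        \<approx> (if w = tail G e then edge e else (0 :: ('v, 'e, 'k) cohn_poly)) * (edges q * defect v * ghosts p')"
      by (intro ideal_cong_right vert_edge w q(2) unital_matrix_unit[OF q(1), of u' p' v'] b[unfolded ab])
    then show ?thesis using q(3) by (auto simp: ab matrix_unit_def Cons edges_Cons mult.assoc)
  qed
qed

text \<open>
  The span of the matrix units modulo the ideal. It turns out to be the whole algebra: it is stable
  under left multiplication by generators, because a generator fixes the left walk, prepends
  an arc to it, removes one from it, or gives zero, and it contains the vertices.
\<close>

inductive_set unit_span :: "('v, 'e, 'k::field) cohn_poly set" where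
  ideal: "p \<in> gen_ideal S (cohn_relators G X) \<Longrightarrow> p \<in> unit_span"
| matrix_unit: "a \<in> W \<Longrightarrow> b \<in> W \<Longrightarrow> target a = target b \<Longrightarrow> matrix_unit a b \<in> unit_span"
| add: "p \<in> unit_span \<Longrightarrow> q \<in> unit_span \<Longrightarrow> p + q \<in> unit_span"
| scale: "p \<in> unit_span \<Longrightarrow> scale c p \<in> unit_span"

lemma unit_span_cong: "p \<approx> q \<Longrightarrow> q \<in> unit_span \<Longrightarrow> p \<in> unit_span"
  using unit_span.add[OF unit_span.ideal, of "p - q" q] by (simp add: ideal_cong_def)

lemma unit_span_zero: "0 \<in> unit_span"
  by (intro unit_span.ideal gen_ideal.zero)

lemma gen_mult_matrix_unit:
  assumes a: "a \<in> W" and b: "b \<in> W" and t: "target a = target b" and g: "g \<in> S"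
  shows "gen g * matrix_unit a b \<in> (unit_span :: ('v, 'e, 'k::field) cohn_poly set)"
proof (cases g)
  case (Vert w)
  then have "w \<in> verts G" using g by (auto simp: cohn_gens_def)
  from unit_span_cong[OF vert_matrix_unit[OF a b this]] show ?thesis
    using unit_span.matrix_unit[OF a b t] unit_span_zero by (cases "w = fst a") (simp_all add: Vert)
next
  case (Edge e)
  then have e: "e \<in> arcs G" "head G e \<in> verts G" using g by (auto simp: cohn_gens_def)
  obtain u p v u' p' v' where ab: "a = (u, p, v)" "b = (u', p', v')" by (cases a, cases b)
  have un: "matrix_unit a b \<in> unital_free_alg S"
    using unital_matrix_unit(1) a b by (simp add: ab matrix_unit_def)
  show ?thesis
  proof (cases "head G e = u")
    case True
    then have "(tail G e, e # p, v) \<in> W"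
      using a e by (auto simp: ab walks_avoiding_def walks_def awalk_Cons_iff)
    from unit_span.matrix_unit[OF this b] show ?thesis
      using t by (simp add: matrix_unit_def ab Edge edges_Cons mult.assoc)
  next
    case False
    have "edge e * matrix_unit a b \<approx> edge e * vert (head G e) * matrix_unit a b"
      by (intro ideal_cong_right edge_head e un)
    also have "\<dots> = edge e * (vert (head G e) * matrix_unit a b)" by (simp add: mult.assoc)
    also have "\<dots> \<approx> edge e * 0"
      using vert_matrix_unit[OF a b e(2)] False by (intro ideal_cong_left unital_gen gens e) (auto simp: ab)
    finally show ?thesis using unit_span_cong unit_span_zero by (auto simp: Edge)
  qed
next
  case (Ghost e)
  then have e: "e \<in> arcs G" "head G e \<in> verts G" using g by (auto simp: cohn_gens_def)
  obtain u p v u' p' v' where ab: "a = (u, p, v)" "b = (u', p', v')" by (cases a, cases b)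
  note un = unital_matrix_unit[of u p v u' p' v'] walks_avoidingD[of u p v]
  show ?thesis
  proof (cases p)
    case Nil
    then have "ghost e * defect v * ghosts p' \<approx> 0 * ghosts p'"
      using un a b by (intro ideal_cong_right ghost_defect e) (auto simp: ab)
    then have "ghost e * matrix_unit a b \<approx> 0" by (simp add: matrix_unit_def ab Nil edges_Nil mult.assoc)
    then show ?thesis using unit_span_cong unit_span_zero by (auto simp: Ghost)
  next
    case (Cons f q)
    have q: "(head G f, q, v) \<in> W" "f \<in> arcs G" "u = tail G f"
      using a un by (auto simp: ab Cons walks_avoiding_def walks_def awalk_Cons_iff)
    let ?c = "(head G f, q, v)"
    have un': "matrix_unit ?c b \<in> unital_free_alg S"
      using unital_matrix_unit(1) q b by (simp add: ab matrix_unit_def)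
    have "ghost e * matrix_unit a b = (ghost e * edge f) * matrix_unit ?c b"
      by (simp add: matrix_unit_def ab Cons edges_Cons mult.assoc)
    also have "\<dots> \<approx> (if e = f then vert (head G e) else 0) * matrix_unit ?c b"
      by (intro ideal_cong_right ghost_edge e q un')
    finally have 1: "ghost e * matrix_unit a b \<approx> (if e = f then vert (head G e) else 0) * matrix_unit ?c b" .
    show ?thesis
    proof (cases "e = f")
      case True
      have "ghost e * matrix_unit a b \<approx> vert (head G e) * matrix_unit ?c b" using 1 True by simp
      also have "\<dots> \<approx> matrix_unit ?c b" using vert_matrix_unit[OF q(1) b e(2)] True by simp
      finally show ?thesis using unit_span_cong unit_span.matrix_unit[OF q(1) b] t by (simp add: ab Ghost)
    next
      case False
      then show ?thesis using 1 unit_span_cong unit_span_zero by (auto simp: Ghost)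
    qed
  qed
qed

lemma gen_mult_unit_span:
  assumes "x \<in> unit_span" "g \<in> S"
  shows "gen g * x \<in> unit_span"
  using assms(1)
proof induction
  case (ideal p)
  then show ?case by (intro unit_span.ideal gen_ideal.mult_left gen_in_free_alg assms)
next
  case (matrix_unit a b)
  then show ?case by (intro gen_mult_matrix_unit assms)
next
  case (add p q)
  then show ?case by (simp add: distrib_left unit_span.add)
next
  case (scale p c)
  then show ?case by (simp add: mult_scale_right unit_span.scale)
qed

lemma unit_span_sum: "(\<And>x. x \<in> A \<Longrightarrow> f x \<in> unit_span) \<Longrightarrow> sum f A \<in> unit_span"
  by (induction A rule: infinite_finite_induct) (auto intro: unit_span_zero unit_span.add)

definition walks_from :: "'v \<Rightarrow> ('e list \<times> 'v) set" where
  "walks_from u = {(p, v). awalk u p v}"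

lemma finite_walks_from: "finite (walks_from u)"
proof -
  have "walks_from u \<subseteq> snd ` walks G" by (force simp: walks_from_def walks_def)
  then show ?thesis using finite_walks by (meson finite_imageI finite_subset)
qed

text \<open>
  The measure for the next induction; it decreases along every arc because prepending the arc
  misses the empty walk. In particular a graph with finitely many walks has no cycles.
\<close>

lemma card_walks_from_less:
  assumes "e \<in> arcs G"
  shows "card (walks_from (head G e)) < card (walks_from (tail G e))"
proof -
  let ?f = "\<lambda>(p, v). (e # p, v)"
  have "?f ` walks_from (head G e) \<subset> walks_from (tail G e)"
  proof (rule psubsetI)
    show "?f ` walks_from (head G e) \<subseteq> walks_from (tail G e)"
      using assms by (auto simp: walks_from_def awalk_Cons_iff)
    have "([], tail G e) \<in> walks_from (tail G e)" using assms by (auto simp: walks_from_def awalk_Nil_iff)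
    then show "?f ` walks_from (head G e) \<noteq> walks_from (tail G e)" by auto
  qed
  then have "card (?f ` walks_from (head G e)) < card (walks_from (tail G e))"
    using finite_walks_from by (rule psubset_card_mono[rotated])
  moreover have "inj_on ?f (walks_from (head G e))" by (auto intro: inj_onI)
  ultimately show ?thesis by (simp add: card_image)
qed

text \<open>
  Expanding \<open>u\<close> as its defect plus \<open>\<Sum>e. e e\<^sup>*\<close> splits \<open>p u q\<^sup>*\<close> into a matrix unit (or zero, if
  \<open>u \<in> X\<close>) and the terms \<open>(p e) (q e)\<^sup>*\<close>, whose walks end further down the graph. The expansion
  stops because there are finitely many walks.
\<close>

lemma path_ghost_path_in_unit_span:
  assumes "awalk x p u" "awalk y q u"
  shows "edges p * vert u * ghosts q \<in> (unit_span :: ('v, 'e, 'k::field) cohn_poly set)"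
  using assms
proof (induction "card (walks_from u)" arbitrary: u p q rule: less_induct)
  case less
  have pq: "set p \<subseteq> arcs G" "set q \<subseteq> arcs G" using less.prems by (auto simp: awalk_def)
  have u: "u \<in> verts G" using less.prems awlast_in_verts by auto
  have "edges p * vert u * ghosts q = edges p * defect u * ghosts q
      + (\<Sum>e\<in>out_arcs G u. edges p * (edge e * ghost e) * (ghosts q :: ('v, 'e, 'k) cohn_poly))"
    by (simp add: defect_def right_diff_distrib left_diff_distrib sum_distrib_left sum_distrib_right)
  moreover have "edges p * defect u * ghosts q \<in> (unit_span :: ('v, 'e, 'k) cohn_poly set)"
  proof (cases "u \<in> X")
    case True
    then have "(defect u :: ('v, 'e, 'k) cohn_poly) \<in> cohn_relators G X"
      unfolding defect_def by (rule cohn_relators.XCK2)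
    then show ?thesis
      by (intro unit_span.ideal gen_ideal_unital_left gen_ideal_unital_right
          unital_edges unital_ghosts pq gen_ideal.base)
  next
    case False
    then have "(x, p, u) \<in> W" "(y, q, u) \<in> W" using less.prems by (auto simp: walks_avoiding_def walks_def)
    from unit_span.matrix_unit[OF this] show ?thesis by (simp add: matrix_unit_def)
  qed
  moreover have "edges p * (edge e * ghost e) * ghosts q \<in> (unit_span :: ('v, 'e, 'k) cohn_poly set)"
    if "e \<in> out_arcs G u" for e
  proof -
    have e: "e \<in> arcs G" "tail G e = u" using that by auto
    have "awalk x (p @ [e]) (head G e)" "awalk y (q @ [e]) (head G e)"
      using less.prems arc_implies_awalk[OF e(1)] e(2) by (auto intro: awalk_appendI)
    then have IH: "edges (p @ [e]) * vert (head G e) * ghosts (q @ [e]) \<in> (unit_span :: ('v, 'e, 'k) cohn_poly set)"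
      using less.hyps card_walks_from_less[OF e(1)] e(2) by blast
    have "edges p * (edge e * ghost e) * ghosts q \<approx>
        edges p * (edge e * vert (head G e) * ghost e) * (ghosts q :: ('v, 'e, 'k) cohn_poly)"
      by (intro ideal_cong_right ideal_cong_left edge_head unital_gen gens unital_edges unital_ghosts pq e)
    also have "\<dots> = edges (p @ [e]) * vert (head G e) * ghosts (q @ [e])"
      by (simp add: edges_snoc ghosts_snoc mult.assoc)
    finally show ?thesis using unit_span_cong IH by blast
  qed
  ultimately show ?case by (auto intro!: unit_span.add unit_span_sum)
qed

lemma vert_in_unit_span:
  assumes "v \<in> verts G" shows "vert v \<in> unit_span"
  using path_ghost_path_in_unit_span[of v "[]" v v "[]"] assms
  by (simp add: awalk_Nil_iff edges_Nil ghosts_Nil)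

lemma gen_in_unit_span:
  assumes "g \<in> S" shows "gen g \<in> unit_span"
proof (cases g)
  case (Vert v)
  then show ?thesis using assms vert_in_unit_span by (auto simp: cohn_gens_def)
next
  case (Edge e)
  then have e: "e \<in> arcs G" using assms by (auto simp: cohn_gens_def)
  then show ?thesis unfolding Edge
    by (intro unit_span_cong[OF edge_head] gen_mult_unit_span vert_in_unit_span gens head_in_verts)
next
  case (Ghost e)
  then have e: "e \<in> arcs G" using assms by (auto simp: cohn_gens_def)
  then show ?thesis unfolding Ghost
    by (intro unit_span_cong[OF ghost_tail] gen_mult_unit_span vert_in_unit_span gens tail_in_verts)
qed

lemma free_alg_subset_unit_span:
  assumes "x \<in> free_alg S" shows "x \<in> unit_span"
proof (induction x rule: ncpoly_induct)
  case zero
  then show ?case by (rule unit_span_zero)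
next
  case (single w c)
  then have "w \<in> lists S" "w \<noteq> []" using assms by (auto simp: free_alg_def)
  then have "Poly_Mapping.single w 1 \<in> unit_span"
  proof (induction rule: lists.induct)
    case (Cons g w)
    have g: "g \<in> S" "w \<in> lists S" by (rule Cons.hyps)+
    show ?case
    proof (cases "w = []")
      case True
      then show ?thesis using gen_in_unit_span[OF g(1)] by (simp add: gen_def)
    next
      case False
      then show ?thesis
        using gen_mult_unit_span[OF Cons.IH[OF False] g(1)] by (simp add: gen_mult_single)
    qed
  qed simp
  then have "scale c (Poly_Mapping.single w 1) \<in> unit_span" by (rule unit_span.scale)
  also have "scale c (Poly_Mapping.single w 1) = Poly_Mapping.single w c"
    by (rule poly_mapping_eqI) (simp add: lookup_scale lookup_single when_def)
  finally show ?case .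
qed (rule unit_span.add)

text \<open>
  The matrix of the representation on walks, in the basis of indicator functions.
\<close>

definition mat :: "('v, 'e, 'k::field) cohn_poly \<Rightarrow> ('v, 'e) walk \<times> ('v, 'e) walk \<Rightarrow> 'k" where
  "mat x = (\<lambda>(a, b). if b \<in> W then rep act x (point b) a else 0)"

lemma mat_add: "mat (x + y) = (\<lambda>s. mat x s + mat y s)"
  by (auto simp: mat_def rep_add)

lemma mat_scale: "mat (scale c x) = (\<lambda>s. c * mat x s)"
  by (auto simp: mat_def rep_scale)

lemma mat_ideal: "x \<in> gen_ideal S (cohn_relators G X) \<Longrightarrow> mat x = (\<lambda>s. 0)"
  by (auto simp: mat_def rep_act_gen_ideal)

lemma foldr_walk_pre:
  "awalk u p v \<Longrightarrow> foldr (walk_pre G) p (v, [], v) = (u, p, v)"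
  by (induction p arbitrary: u) (auto simp: awalk_Nil_iff awalk_Cons_iff walk_pre_def)

lemma rep_ghosts:
  assumes "awalk u p v" "v \<notin> X"
  shows "rep act (ghosts p) \<phi> (v, [], v) = \<phi> (u, p, v)"
proof -
  have "foldr act (map Ghost (rev p)) \<phi> (v, [], v) = \<phi> (foldr (walk_pre G) p (v, [], v))"
    using assms(1)
  proof (induction p arbitrary: u \<phi>)
    case (Cons e p)
    then have p: "awalk (head G e) p v" "e \<in> arcs G" by (auto simp: awalk_Cons_iff)
    then have mem: "(head G e, p, v) \<in> W" using assms(2) by (simp add: walks_avoiding_def walks_def)
    have "foldr act (map Ghost (rev (e # p))) \<phi> (v, [], v) = act (Ghost e) \<phi> (foldr (walk_pre G) p (v, [], v))"
      using Cons.IH[OF p(1), of "act (Ghost e) \<phi>"] by (simp del: act.simps)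
    also have "\<dots> = \<phi> (walk_pre G e (foldr (walk_pre G) p (v, [], v)))"
      unfolding foldr_walk_pre[OF p(1)] using p(2) mem by simp
    finally show ?case by simp
  qed simp
  then show ?thesis using foldr_walk_pre[OF assms(1)] by (simp add: ghosts_def rep_single)
qed

lemma rep_defect:
  assumes "v \<in> verts G" "v \<notin> X"
  shows "rep act (defect v) \<phi> = (\<lambda>b. \<phi> (v, [], v) * point (v, [], v) b)"
proof
  fix b
  have "rep act (defect v) \<phi> b = act (Vert v) \<phi> b - (\<Sum>e\<in>out_arcs G v. act (Edge e) (act (Ghost e) \<phi>) b)"
    by (simp only: defect_def rep_minus rep_sum rep_act_gen_gen rep_gen)
  also have "\<dots> = act (Vert v) \<phi> b - (if \<exists>e\<in>out_arcs G v. \<exists>c. starts_with e b c then \<phi> b else 0)"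
    unfolding sum_act_Edge_Ghost[OF finite_out_arcs] ..
  also have "\<dots> = \<phi> (v, [], v) * point (v, [], v) b"
  proof (cases "b \<in> W \<and> fst b = v")
    case False
    then have "\<not> (\<exists>e\<in>out_arcs G v. \<exists>c. starts_with e b c)" by (auto dest: starts_with_in)
    moreover have "b \<noteq> (v, [], v)" using False assms by (auto simp: walks_avoiding_def walks_def awalk_Nil_iff)
    ultimately show ?thesis using False by (auto simp: point_def)
  next
    case True
    then obtain p z where b: "b = (v, p, z)" "awalk v p z" "z \<notin> X"
      by (cases b) (auto simp: walks_avoiding_def walks_def)
    show ?thesis
    proof (cases p)
      case Nil
      then have "b = (v, [], v)" using b by (auto simp: awalk_Nil_iff)
      moreover from this have "\<not> starts_with e b c" for e c
        by (auto simp: starts_with_def walk_pre_def split: prod.splits)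
      ultimately show ?thesis using True by (simp add: point_def)
    next
      case (Cons e q)
      then have e: "e \<in> arcs G" "tail G e = v" "awalk (head G e) q z"
        using b by (auto simp: awalk_Cons_iff)
      then have "(head G e, q, z) \<in> W" using b by (simp add: walks_avoiding_def walks_def)
      then have "starts_with e b (head G e, q, z)" "e \<in> out_arcs G v"
        using e b Cons by (simp_all add: starts_with_def walk_pre_def)
      then have "\<exists>e\<in>out_arcs G v. \<exists>c. starts_with e b c" by blast
      then show ?thesis using True Cons b by (simp add: point_def)
    qed
  qed
  finally show "rep act (defect v) \<phi> b = \<phi> (v, [], v) * point (v, [], v) b" .
qed

text \<open>
  The ghosts of \<open>b\<close> read off the value at \<open>b\<close> at the empty walk, the defect discards all other
  values, and the edges of \<open>a\<close> transport the result to \<open>a\<close>.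
\<close>

lemma rep_matrix_unit:
  assumes "a \<in> W" "b \<in> W" "target a = target b"
  shows "rep act (matrix_unit a b) \<phi> = (\<lambda>x. \<phi> b * point a x)"
proof -
  obtain u p v u' p' where ab: "a = (u, p, v)" "b = (u', p', v)"
    using assms(3) by (cases a, cases b) auto
  have w: "awalk u p v" "v \<in> verts G" "v \<notin> X" "awalk u' p' v" using assms walks_avoidingD by (auto simp: ab)
  have v: "(v, [], v) \<in> W" using w by (auto simp: walks_avoiding_def walks_def awalk_Nil_iff)
  have "rep act (matrix_unit a b) \<phi> = rep act (edges p) (rep act (defect v) (rep act (ghosts p') \<phi>))"
    by (simp add: matrix_unit_def ab rep_act_mult)
  also have "\<dots> = rep act (edges p) (\<lambda>x. \<phi> b * point (v, [], v) x)"
    by (simp only: rep_defect[OF w(2,3)] rep_ghosts[OF w(4,3)] ab)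
  also have "\<dots> = (\<lambda>x. \<phi> b * rep act (edges p) (point (v, [], v)) x)"
    by (rule lin_op_scale[OF lin_op_rep[OF lin_op_act]])
  also have "rep act (edges p) (point (v, [], v)) = (point a :: _ \<Rightarrow> 'a)"
    using foldr_act_Edge_point[OF w(1) v, where 'k='a] foldr_walk_pre[OF w(1)]
    by (simp add: edges_def rep_single ab)
  finally show ?thesis .
qed

lemma mat_matrix_unit:
  assumes "a \<in> W" "b \<in> W" "target a = target b"
  shows "mat (matrix_unit a b) = point (a, b)"
  using assms by (auto simp: mat_def rep_matrix_unit point_def fun_eq_iff)

lemma mat_in_carrier:
  assumes x: "x \<in> free_alg S"
  shows "mat x \<in> carrier (block_matrices TYPE('k::field) W target)"
  using free_alg_subset_unit_span[OF x]
proof induction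
  case (ideal p)
  then show ?case by (simp add: mat_ideal)
next
  case (matrix_unit a b)
  then show ?case unfolding mat_matrix_unit[OF matrix_unit] by (intro point_in_block_matrices)
next
  case (add p q)
  then show ?case unfolding mat_add using op_closed_block_matrices[of W target, where 'k='k]
    by (simp only: op_closed_def block_matrices_simps(3))
next
  case (scale p c)
  then show ?case unfolding mat_scale using op_closed_block_matrices[of W target, where 'k='k]
    by (simp only: op_closed_def block_matrices_simps(5))
qed

text \<open>
  The inverse of \<^const>\<open>mat\<close>, up to the ideal.
\<close>

definition comb :: "(('v, 'e) walk \<times> ('v, 'e) walk \<Rightarrow> 'k) \<Rightarrow> ('v, 'e, 'k::field) cohn_poly" where
  "comb f = (\<Sum>(a, b)\<in>{(a, b). a \<in> W \<and> b \<in> W \<and> target a = target b}. scale (f (a, b)) (matrix_unit a b))"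

lemma finite_pairs: "finite {(a, b). a \<in> W \<and> b \<in> W \<and> target a = target b}"
  by (rule finite_subset[of _ "W \<times> W"]) (use finite_W in auto)

lemma mat_sum: "mat (sum f A) = (\<lambda>s. \<Sum>x\<in>A. mat (f x) s)"
  by (induction A rule: infinite_finite_induct) (auto simp: mat_add, auto simp: mat_def rep_zero)

lemma mat_comb:
  assumes "f \<in> carrier (block_matrices TYPE('k::field) W target)"
  shows "mat (comb f) = f"
proof -
  let ?D = "{(a, b). a \<in> W \<and> b \<in> W \<and> target a = target b}"
  have "mat (comb f) = (\<lambda>x. \<Sum>s\<in>?D. f s * point s x)"
    unfolding comb_def mat_sum by (rule ext, rule sum.cong) (auto simp: mat_scale mat_matrix_unit)
  also have "\<dots> = f"
    by (rule fun_eq_sum_points[symmetric, OF finite_pairs]) (use assms in auto)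
  finally show ?thesis .
qed

text \<open>
  Both sides are linear in \<open>x\<close> and agree on matrix units. As everything lies in the span of these,
  \<^const>\<open>mat\<close> is injective modulo the ideal.
\<close>

lemma unit_span_cong_comb:
  fixes x :: "('v, 'e, 'k::field) cohn_poly"
  assumes "x \<in> unit_span"
  shows "x \<approx> comb (mat x)"
  using assms
proof induction
  case (ideal p)
  then show ?case by (simp add: mat_ideal comb_def ideal_cong_def case_prod_beta scale_zero_left)
next
  case (matrix_unit a b)
  let ?D = "{(a, b). a \<in> W \<and> b \<in> W \<and> target a = target b}"
  have "comb (point (a, b)) = (\<Sum>s\<in>?D. if s = (a, b) then (matrix_unit a b :: ('v, 'e, 'k) cohn_poly) else 0)"
    unfolding comb_def
  proof (rule sum.cong, rule refl, clarify)
    fix c d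
    show "scale (point (a, b) (c, d)) (matrix_unit c d) = (if (c, d) = (a, b) then matrix_unit a b else 0)"
      by (cases "(c, d) = (a, b)")
        (auto simp: point_def scale_zero_left single_Nil_mult[symmetric] zero_list_def[symmetric])
  qed
  also have "\<dots> = matrix_unit a b" using matrix_unit by (simp add: finite_pairs)
  finally have "comb (point (a, b)) = (matrix_unit a b :: ('v, 'e, 'k) cohn_poly)" .
  then show ?case unfolding mat_matrix_unit[OF matrix_unit] by (simp only: ideal_cong_refl)
next
  case (add p q)
  have "comb (\<lambda>s. mat p s + mat q s) = comb (mat p) + comb (mat q)"
    unfolding comb_def sum.distrib[symmetric]
    by (rule sum.cong) (auto simp: poly_mapping_eq_iff fun_eq_iff lookup_scale lookup_add algebra_simps)
  then show ?case using add by (simp add: mat_add ideal_cong_add)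
next
  case (scale p c)
  have "comb (\<lambda>s. c * mat p s) = Poly_Mapping.single [] c * comb (mat p)"
    unfolding comb_def sum_distrib_left
    by (rule sum.cong) (auto simp: single_Nil_mult poly_mapping_eq_iff fun_eq_iff lookup_scale)
  moreover have "Poly_Mapping.single [] c * p \<approx> Poly_Mapping.single [] c * comb (mat p)"
    using scale by (intro ideal_cong_left unital_single) auto
  ultimately show ?case by (simp add: mat_scale single_Nil_mult)
qed

lemma comb_in_free_alg: "comb f \<in> free_alg S"
proof -
  have "matrix_unit a b \<in> free_alg S" if ab: "a \<in> W" "b \<in> W" for a b
  proof -
    obtain u p v u' p' v' where eq: "a = (u, p, v)" "b = (u', p', v')" by (cases a, cases b)
    have "defect v \<in> free_alg S" using walks_avoidingD[of u p v] ab(1) by (simp add: eq defect_in_free_alg)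
    then show ?thesis
      using walks_avoidingD[of u p v] walks_avoidingD[of u' p' v'] ab
      unfolding eq matrix_unit_def fst_conv snd_conv
      by (intro free_alg_unital_right[OF free_alg_unital_left] unital_edges unital_ghosts
          defect_in_free_alg) simp_all
  qed
  then show ?thesis unfolding comb_def by (intro free_alg_sum) (auto intro!: free_alg_scale)
qed

lemma mat_mult:
  assumes "y \<in> free_alg S"
  shows "mat (x * y) = alg_mult (block_matrices TYPE('k::field) W target) (mat x) (mat y)"
proof (rule ext, clarify)
  fix a b :: "('v, 'e) walk"
  show "mat (x * y) (a, b) = alg_mult (block_matrices TYPE('k) W target) (mat x) (mat y) (a, b)"
  proof (cases "b \<in> W")
    case False
    then show ?thesis by (simp add: mat_def)
  next
    case True
    have out: "rep act y (point b) c = 0" if "c \<notin> W" for c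
    proof (rule ccontr)
      assume "rep act y (point b) c \<noteq> 0"
      then have "mat y (c, b) \<noteq> 0" using True by (simp add: mat_def)
      then show False using mat_in_carrier[OF assms, unfolded block_matrices_simps] that by blast
    qed
    \<comment> \<open>the action of \<open>y\<close> on a point of \<open>W\<close> stays in the span of the points of the finite set \<open>W\<close>\<close>
    have "rep act (x * y) (point b) = rep act x (\<lambda>z. \<Sum>c\<in>W. rep act y (point b) c * point c z)"
      unfolding rep_act_mult using fun_eq_sum_points[OF finite_W out] by simp
    also have "\<dots> = (\<lambda>z. \<Sum>c\<in>W. rep act y (point b) c * rep act x (point c) z)"
      by (rule lin_op_sum[OF lin_op_rep[OF lin_op_act]])
    finally show ?thesis using True by (simp add: mat_def mult.commute)
  qed
qed

lemma cohn_path_algebra_iso_block_matrices: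
  "cohn_path_algebra TYPE('k::field) G X \<cong>\<^sub>a block_matrices TYPE('k) W target"
  unfolding cohn_path_algebra_def
proof (rule presented_alg_iso[where \<Phi> = mat])
  let ?R = "cohn_relators G X :: ('v, 'e, 'k) cohn_poly set"
  show "?R \<subseteq> free_alg S" by (rule cohn_relators_subset[OF wf_digraph_axioms X_regular])
  show "x - y \<in> gen_ideal S ?R \<longleftrightarrow> mat x = mat y" if "x \<in> free_alg S" "y \<in> free_alg S" for x y
  proof
    assume "x - y \<in> gen_ideal S ?R"
    then have "mat (x - y) = (\<lambda>s. 0)" by (rule mat_ideal)
    then have "mat ((x - y) + y) = mat y" by (simp only: mat_add) simp
    then show "mat x = mat y" by simp
  next
    assume eq: "mat x = mat y"
    have "x \<approx> comb (mat x)" "comb (mat y) \<approx> y"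
      using that unit_span_cong_comb free_alg_subset_unit_span ideal_cong_sym by blast+
    then have "x \<approx> y" unfolding eq by (rule ideal_cong_trans)
    then show "x - y \<in> gen_ideal S ?R" by (simp add: ideal_cong_def)
  qed
  show "mat ` free_alg S = carrier (block_matrices TYPE('k) W target)"
    using mat_in_carrier mat_comb comb_in_free_alg
    by (metis (no_types, lifting) image_eqI subsetI subset_antisym image_subsetI)
qed (simp_all only: mat_add mat_mult mat_scale block_matrices_simps)

end

section \<open>Independence of the field\<close>

text \<open>
  The two graphs have, up to a matching of the vertices outside \<open>X\<close> and \<open>Y\<close>, the same numbers of
  walks ending at these vertices. No field occurs in this condition.
\<close>

definition matching_walks :: "('v1, 'e1) pre_digraph \<Rightarrow> 'v1 set \<Rightarrow> ('v2, 'e2) pre_digraph \<Rightarrow> 'v2 set \<Rightarrow> bool" where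
  "matching_walks G X H Y \<longleftrightarrow> (\<exists>\<sigma>. bij_betw \<sigma> (walks_avoiding G X) (walks_avoiding H Y) \<and>
     (\<forall>a\<in>walks_avoiding G X. \<forall>b\<in>walks_avoiding G X.
        target a = target b \<longleftrightarrow> target (\<sigma> a) = target (\<sigma> b)))"

lemma cohn_iso_block_matrices:
  assumes "wf_digraph G" "X \<subseteq> regular_verts G" "finite (walks G)"
  shows "cohn_path_algebra TYPE('k::field) G X \<cong>\<^sub>a block_matrices TYPE('k) (walks_avoiding G X) target"
proof -
  interpret branching_system G X "walks_avoiding G X" fst "walk_pre G"
    by (rule walk_branching_system) fact+
  interpret finite_walk_graph G X by unfold_locales fact
  show ?thesis by (rule cohn_path_algebra_iso_block_matrices)
qed

lemma op_closed_cohn_path_algebra: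
  assumes "wf_digraph G" "X \<subseteq> regular_verts G"
  shows "op_closed (cohn_path_algebra TYPE('k::field) G X)"
  unfolding cohn_path_algebra_def by (intro op_closed_presented_alg cohn_relators_subset assms)

lemma finite_dim_if_block_matrices_iso:
  assumes "finite P" "block_matrices TYPE('k::field) P col \<cong>\<^sub>a cohn_path_algebra TYPE('k) G X"
  shows "alg_finite_dim (cohn_path_algebra TYPE('k) G X)"
proof -
  obtain h where h: "alg_iso (block_matrices TYPE('k) P col) (cohn_path_algebra TYPE('k) G X) h"
    using assms(2) by (auto simp: alg_isomorphic_def)
  show ?thesis
  proof (rule finite_dim_iso[OF h op_closed_block_matrices])
    fix y assume "y \<in> carrier (cohn_path_algebra TYPE('k) G X)"
    then obtain p where "y = coset (gen_ideal (cohn_gens G) (cohn_relators G X)) p"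
      by (auto simp: cohn_path_algebra_def presented_alg_def Let_def)
    then have "alg_smult (cohn_path_algebra TYPE('k) G X) 0 y
       = coset (gen_ideal (cohn_gens G) (cohn_relators G X)) (scale 0 p)"
      unfolding cohn_path_algebra_def by (simp only: presented_alg_smult)
    then show "alg_smult (cohn_path_algebra TYPE('k) G X) 0 y = alg_zero (cohn_path_algebra TYPE('k) G X)"
      by (simp add: scale_zero_left cohn_path_algebra_def presented_alg_def Let_def)
  qed (use block_matrices_finite_dim[OF assms(1)] in simp_all)
qed

text \<open>
  An isomorphism transports finite-dimensionality to the algebra of \<open>H\<close>. This bounds the walks of
  \<open>H\<close>, so that both algebras have their matrix form.
\<close>

lemma cohn_path_algebra_iso_iff:
  assumes G: "wf_digraph G" "X \<subseteq> regular_verts G" "finite (walks G)"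
    and H: "wf_digraph H" "Y \<subseteq> regular_verts H"
  shows "cohn_path_algebra TYPE('k::field) G X \<cong>\<^sub>a cohn_path_algebra TYPE('k) H Y
    \<longleftrightarrow> finite (walks H) \<and> matching_walks G X H Y"
proof -
  let ?A = "cohn_path_algebra TYPE('k) G X" and ?B = "cohn_path_algebra TYPE('k) H Y"
  let ?M = "block_matrices TYPE('k) (walks_avoiding G X) target"
  let ?N = "block_matrices TYPE('k) (walks_avoiding H Y) target"
  have finG: "finite (walks_avoiding G X)"
    by (rule finite_subset[OF _ G(3)]) (auto simp: walks_avoiding_def)
  have finH: "finite (walks_avoiding H Y)" if "finite (walks H)"
    by (rule finite_subset[OF _ that]) (auto simp: walks_avoiding_def)
  have AM: "?A \<cong>\<^sub>a ?M" by (rule cohn_iso_block_matrices[OF G])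
  have MA: "?M \<cong>\<^sub>a ?A" by (rule alg_isomorphic_sym[OF op_closed_cohn_path_algebra[OF G(1,2)] AM])
  have BN: "?B \<cong>\<^sub>a ?N" if "finite (walks H)" by (rule cohn_iso_block_matrices[OF H that])
  show ?thesis
  proof
    assume "?A \<cong>\<^sub>a ?B"
    with MA have MB: "?M \<cong>\<^sub>a ?B" by (rule alg_isomorphic_trans)
    then have "alg_finite_dim ?B" by (rule finite_dim_if_block_matrices_iso[OF finG])
    then have fin: "finite (walks H)" by (rule finite_walks_if_finite_dim[OF H])
    have "?M \<cong>\<^sub>a ?N" using MB BN[OF fin] by (rule alg_isomorphic_trans)
    then have "matching_walks G X H Y"
      unfolding matching_walks_def using finG finH[OF fin] by (rule bijection_if_block_matrices_iso)
    with fin show "finite (walks H) \<and> matching_walks G X H Y" by blast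
  next
    assume R: "finite (walks H) \<and> matching_walks G X H Y"
    then obtain \<sigma> where \<sigma>: "bij_betw \<sigma> (walks_avoiding G X) (walks_avoiding H Y)"
      "\<And>a b. a \<in> walks_avoiding G X \<Longrightarrow> b \<in> walks_avoiding G X
        \<Longrightarrow> target a = target b \<longleftrightarrow> target (\<sigma> a) = target (\<sigma> b)"
      unfolding matching_walks_def by blast
    then have MN: "?M \<cong>\<^sub>a ?N" by (rule block_matrices_iso_if_bijection)
    have NB: "?N \<cong>\<^sub>a ?B"
      using op_closed_cohn_path_algebra[OF H] BN R by (blast intro: alg_isomorphic_sym)
    show "?A \<cong>\<^sub>a ?B" by (rule alg_isomorphic_trans[OF AM alg_isomorphic_trans[OF MN NB]])
  qed
qed

theorem corollary4p11:
  fixes E1 :: "('v1, 'e1) pre_digraph" and X1 :: "'v1 set"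
    and E2 :: "('v2, 'e2) pre_digraph" and X2 :: "'v2 set"
  assumes char: "CHAR('k::alg_closed_field) = CHAR('l::alg_closed_field)"
    and graphs: "wf_digraph E1" "wf_digraph E2"
    and regular: "X1 \<subseteq> regular_verts E1" "X2 \<subseteq> regular_verts E2"
    and findim: "alg_finite_dim (cohn_path_algebra TYPE('k) E1 X1)"
  shows "cohn_path_algebra TYPE('k) E1 X1 \<cong>\<^sub>a cohn_path_algebra TYPE('k) E2 X2
    \<longleftrightarrow> cohn_path_algebra TYPE('l) E1 X1 \<cong>\<^sub>a cohn_path_algebra TYPE('l) E2 X2"
proof -
  have "finite (walks E1)"
    by (rule finite_walks_if_finite_dim[OF graphs(1) regular(1) findim])
  note iff = cohn_path_algebra_iso_iff[OF graphs(1) regular(1) this graphs(2) regular(2)]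
  show ?thesis unfolding iff ..
qed

end
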